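(* Let $\lambda\in(-1/2,\infty)$ be fixed, let $d\sigma=w^\lambda\,dx$ on $[-1,1]$, and let $\mathcal H_{n+1}\subseteq L^2([-1,1],\sigma)$ be the span of the first $n+1$ orthogonal polynomials (degrees $0,\dots,n$) associated to $\sigma$. Let $\mathrm E(\lambda,n+1)$ be the expected value of the logarithmic energy $-\sum_{i\ne j}\log|x_i-x_j|$ of the $n+1$ points $x_0,\ldots,x_n$ output by the determinantal point process associated with $\mathcal H_{n+1}$. Then, as $n\to\infty$, $$\mathrm E(\lambda,n+1)=(n+1)^2\log 2-(n+1)\log(n+1)+(1-\gamma-2\log 2)\,n+o(n)$$ (so that the dependence on $\lambda$ is only in the remainder $o(n)$). Moreover, in the case $\lambda=0$ one has, for every integer $n\ge1$, the exact expression $$\mathrm E(0,n+1)=(n+1)^2\log 2-\Big((n+1)\log 2+\tfrac34 H_n+nH_{2n-1}+\tfrac{H_{2n}}{2}-n+\tfrac12\Big),$$ and, as $n\to\infty$, $$\mathrm E(0,n+1)=(n+1)^2\log 2-(n+1)\log(n+1)+(1-\gamma-2\log 2)\,n-\tfrac14\log n+O(1).$$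
   Context: $w^\lambda(x)=\frac{\Gamma(\lambda+1)}{\sqrt{\pi}\,\Gamma(\lambda+1/2)}(1-x^2)^{\lambda-1/2}$, a probability density on $[-1,1]$. Its orthogonal polynomials are the Gegenbauer polynomials $C_k^\lambda$ (Chebyshev polynomials $T_k$ when $\lambda=0$). Let $\widehat C^\lambda_k$ ($k\ge0$, degree $k$) be the orthonormal polynomials with respect to $w^\lambda dx$ and $K_n^\lambda(x,y)=\sum_{k=0}^n\widehat C_k^\lambda(x)\widehat C_k^\lambda(y)$, the projection kernel onto $\mathcal H_{n+1}$. The determinantal point process (DPP) associated with $\mathcal H_{n+1}$ is the random point process with kernel $K_n^\lambda$ with respect to $\sigma$: almost surely it outputs $n+1$ distinct points, and for functions $f$ for which the integral makes sense (possibly undefined on the diagonal) $$\mathrm E\Big(\sum_{i\ne j}f(x_i,x_j)\Big)=\iint_{[-1,1]^2}\big(K_n^\lambda(x,x)K_n^\lambda(y,y)-K_n^\lambda(x,y)^2\big)f(x,y)\,d\sigma(x)\,d\sigma(y).$$ Thus $\mathrm E(\lambda,n+1)$ is the right-hand side with $f(x,y)=\log\frac1{|x-y|}$. $H_n=1+\frac12+\cdots+\frac1n$ is the $n$-th harmonic number and $\gamma$ is the Euler–Mascheroni constant. *)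

theory Defs
  imports
    "HOL-Probability.Probability"
    "HOL-Computational_Algebra.Polynomial"
    "HOL-Library.Landau_Symbols"
    "Jordan_Normal_Form.Determinant"
begin

definition gegenbauer_weight :: "real \<Rightarrow> real \<Rightarrow> real" where
  "gegenbauer_weight l x =
     Gamma (l + 1) / (sqrt pi * Gamma (l + 1/2)) * (1 - x\<^sup>2) powr (l - 1/2)"

(* The indicator is essential: powr does not vanish for a negative base. *)
definition gegenbauer_measure :: "real \<Rightarrow> real measure" where
  "gegenbauer_measure l =
     density lborel (\<lambda>x. ennreal (indicator {-1..1} x * gegenbauer_weight l x))"

(* Determines each C k up to sign, and hence the projection kernel below uniquely. *)
definition orthonormal_polynomials :: "real measure \<Rightarrow> (nat \<Rightarrow> real poly) \<Rightarrow> bool" where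
  "orthonormal_polynomials \<sigma> C \<longleftrightarrow>
     (\<forall>k. degree (C k) = k) \<and>
     (\<forall>j k. (\<integral>x. poly (C j) x * poly (C k) x \<partial>\<sigma>) = (if j = k then 1 else 0))"

definition projection_kernel :: "(nat \<Rightarrow> real poly) \<Rightarrow> nat \<Rightarrow> real \<Rightarrow> real \<Rightarrow> real" where
  "projection_kernel C n x y = (\<Sum>k\<le>n. poly (C k) x * poly (C k) y)"

(* X 0, ..., X (N - 1) enumerate, in an arbitrary order, a simple point process with N points.
   It is determinantal with kernel K with respect to \<sigma> if, for every k, its k-point
   correlation function with respect to \<sigma> is det (K (x i) (x j)). This is tested against all
   nonnegative measurable f, summed over all k-tuples of points with pairwise distinct indices.
   For k = 2 the determinant is K x x * K y y - K x y * K y x. The truncation by ennreal is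
   harmless for positive semidefinite K, such as a projection kernel. *)
definition determinantal_points ::
  "real measure \<Rightarrow> (real \<Rightarrow> real \<Rightarrow> real) \<Rightarrow> nat \<Rightarrow> 'a measure \<Rightarrow> (nat \<Rightarrow> 'a \<Rightarrow> real) \<Rightarrow> bool" where
  "determinantal_points \<sigma> K N M X \<longleftrightarrow>
     prob_space M \<and>
     (\<forall>i<N. X i \<in> borel_measurable M) \<and>
     (AE \<omega> in M. inj_on (\<lambda>i. X i \<omega>) {..<N}) \<and>
     (\<forall>k. \<forall>f :: (nat \<Rightarrow> real) \<Rightarrow> ennreal. f \<in> borel_measurable (PiM {..<k} (\<lambda>_. borel)) \<longrightarrow>
        (\<integral>\<^sup>+ \<omega>. (\<Sum>s \<in> {s \<in> {..<k} \<rightarrow>\<^sub>E {..<N}. inj_on s {..<k}}.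
                  f (\<lambda>i\<in>{..<k}. X (s i) \<omega>)) \<partial>M)
        = (\<integral>\<^sup>+ x. ennreal (Determinant.det (Matrix.mat k k (\<lambda>(i, j). K (x i) (x j)))) * f x
             \<partial>(PiM {..<k} (\<lambda>_. \<sigma>))))"

definition log_energy :: "nat \<Rightarrow> (nat \<Rightarrow> real) \<Rightarrow> real" where
  "log_energy N x = - (\<Sum>i<N. \<Sum>j \<in> {..<N} - {i}. ln \<bar>x i - x j\<bar>)"

definition expected_log_energy :: "'a measure \<Rightarrow> nat \<Rightarrow> (nat \<Rightarrow> 'a \<Rightarrow> real) \<Rightarrow> real" where
  "expected_log_energy M N X = (\<integral>\<omega>. log_energy N (\<lambda>i. X i \<omega>) \<partial>M)"

end

(* The joint density of the n + 1 points is proportional to the squared Vandermonde product, so after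
   the substitution x = 2 u - 1 the expected energy is minus the logarithmic derivative at g = 1 of the
   Selberg integral S(g), the integral over [0,1]^(n+1) of |Vandermonde|^(2 g) against the product of
   beta weights with parameters a = b = l + 1/2.  The Selberg integral is evaluated for real g by
   Aomoto's recurrence under a |-> a + 1, a uniqueness argument in the style of Bohr and Mollerup, and
   induction on the number of variables, where an integration by parts with a boundary term at u = 0
   removes one variable.  The energy thus becomes a finite sum of Digamma values; such sums telescope,
   and the asymptotics of Digamma finish the proof. *)

theory Submission
  imports Defs "HOL-Real_Asymp.Real_Asymp"
begin

section \<open>Finite powers of a measure\<close>

text \<open>A derivative in \<open>g\<close> is wanted, so integer \<open>g\<close> would not be
  enough: \<open>g\<close> is a fixed real number throughout, while \<open>a\<close> and the number
  of variables move. The evaluation is confined to \<open>g \<ge> 1\<close>. There |y - c|^(2 g) is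
  continuously differentiable even at y = c, and the product of such factors stays bounded when
  divided by one difference. Each integration by parts is therefore the fundamental theorem of
  calculus on all of [0,1], with no cuts at the other points. The price is that only the right
  derivative at g = 1 is available; dominated convergence identifies it with the integral of V ln V,
  where V is the squared Vandermonde product. Normalising constants are never evaluated: the energy
  is a quotient of two integrals against the same density. In the linear term the Euler-Mascheroni
  constant comes from Digamma 2, hence from the n + 1 factors Gamma (1 + g) in Selberg's formula,
  and stretching [0,1] to [-1,1] contributes - n (n + 1) ln 2. The weight first shows in (a^2 - a)
  ln (n + 1), where a^2 - a = l^2 - 1/4; this is o(n), and at l = 0 it is the term - 1/4 log
  n.\<close>

lemma PiM_distr_const:
  assumes I: "finite I" and M: "finite_measure M" and f[measurable]: "f \<in> measurable M N"
  shows "PiM I (\<lambda>_. distr M N f) = distr (PiM I (\<lambda>_. M)) (PiM I (\<lambda>_. N)) (\<lambda>x. \<lambda>i\<in>I. f (x i))"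
proof -
  interpret M: finite_measure M by fact
  \<comment> \<open>Sigma-finiteness can be lost under an image measure, finiteness cannot; hence a
    finite \<open>M\<close>.\<close>
  interpret D: finite_measure "distr M N f" by (rule M.finite_measure_distr[OF f])
  interpret PM: product_sigma_finite "\<lambda>_. M" by standard
  interpret PD: product_sigma_finite "\<lambda>_. distr M N f" by standard
  have sets_eq: "sets (PiM I (\<lambda>_. distr M N f)) = sets (PiM I (\<lambda>_. N))"
    by (intro sets_PiM_cong) auto
  show ?thesis
  proof (rule PD.PiM_eqI[OF I, symmetric])
    fix A :: "_ \<Rightarrow> _" assume "\<And>i. i \<in> I \<Longrightarrow> A i \<in> sets (distr M N f)"
    then have A: "\<And>i. i \<in> I \<Longrightarrow> A i \<in> sets N" by simp
    have "(\<lambda>x. \<lambda>i\<in>I. f (x i)) -` Pi\<^sub>E I A \<inter> space (PiM I (\<lambda>_. M)) = Pi\<^sub>E I (\<lambda>i. f -` A i \<inter> space M)"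
      by (auto simp: space_PiM PiE_iff extensional_def)
    then have "emeasure (distr (PiM I (\<lambda>_. M)) (PiM I (\<lambda>_. N)) (\<lambda>x. \<lambda>i\<in>I. f (x i))) (Pi\<^sub>E I A)
        = emeasure (PiM I (\<lambda>_. M)) (Pi\<^sub>E I (\<lambda>i. f -` A i \<inter> space M))"
      using I A by (subst emeasure_distr) (auto intro!: sets_PiM_I_finite)
    also have "\<dots> = (\<Prod>i\<in>I. emeasure M (f -` A i \<inter> space M))"
      using I A by (intro PM.emeasure_PiM) auto
    finally show "emeasure (distr (PiM I (\<lambda>_. M)) (PiM I (\<lambda>_. N)) (\<lambda>x. \<lambda>i\<in>I. f (x i))) (Pi\<^sub>E I A)
        = (\<Prod>i\<in>I. emeasure (distr M N f) (A i))"
      using A by (auto simp: emeasure_distr intro!: prod.cong)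
  qed (simp add: sets_eq)
qed

lemma PiM_density_const:
  assumes I: "finite I" and M: "sigma_finite_measure M" "sigma_finite_measure (density M f)"
    and f[measurable]: "f \<in> borel_measurable M"
  shows "PiM I (\<lambda>_. density M f) = density (PiM I (\<lambda>_. M)) (\<lambda>x. \<Prod>i\<in>I. f (x i))"
proof -
  interpret M: sigma_finite_measure M by fact
  interpret D: sigma_finite_measure "density M f" by fact
  interpret PM: product_sigma_finite "\<lambda>_. M" by standard
  interpret PD: product_sigma_finite "\<lambda>_. density M f" by standard
  have sets_eq: "sets (PiM I (\<lambda>_. density M f)) = sets (PiM I (\<lambda>_. M))"
    by (intro sets_PiM_cong) auto
  show ?thesis
  proof (rule PD.PiM_eqI[OF I, symmetric])
    fix A :: "_ \<Rightarrow> _" assume "\<And>i. i \<in> I \<Longrightarrow> A i \<in> sets (density M f)"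
    then have A: "\<And>i. i \<in> I \<Longrightarrow> A i \<in> sets M" by simp
    have "emeasure (density (PiM I (\<lambda>_. M)) (\<lambda>x. \<Prod>i\<in>I. f (x i))) (Pi\<^sub>E I A)
        = (\<integral>\<^sup>+x. (\<Prod>i\<in>I. f (x i)) * indicator (Pi\<^sub>E I A) x \<partial>PiM I (\<lambda>_. M))"
      using I A by (subst emeasure_density) (auto intro!: sets_PiM_I_finite)
    also have "\<dots> = (\<integral>\<^sup>+x. (\<Prod>i\<in>I. f (x i) * indicator (A i) (x i)) \<partial>PiM I (\<lambda>_. M))"
    proof (rule nn_integral_cong)
      fix x assume "x \<in> space (PiM I (\<lambda>_. M))"
      then have "indicator (Pi\<^sub>E I A) x = (\<Prod>i\<in>I. indicator (A i) (x i) :: ennreal)"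
        using I by (auto simp: space_PiM PiE_iff indicator_def split: if_splits intro!: prod.neutral)
      then show "(\<Prod>i\<in>I. f (x i)) * indicator (Pi\<^sub>E I A) x = (\<Prod>i\<in>I. f (x i) * indicator (A i) (x i))"
        by (simp add: prod.distrib)
    qed
    also have "\<dots> = (\<Prod>i\<in>I. \<integral>\<^sup>+y. f y * indicator (A i) y \<partial>M)"
      using I A by (intro PM.product_nn_integral_prod) auto
    finally show "emeasure (density (PiM I (\<lambda>_. M)) (\<lambda>x. \<Prod>i\<in>I. f (x i))) (Pi\<^sub>E I A)
        = (\<Prod>i\<in>I. emeasure (density M f) (A i))"
      using A by (auto simp: emeasure_density intro!: prod.cong)
  qed (simp add: sets_eq)
qed

lemma distr_PiM_permute:
  assumes I: "finite I" and M: "sigma_finite_measure M" and \<pi>: "\<pi> permutes I"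
  shows "distr (PiM I (\<lambda>_. M)) (PiM I (\<lambda>_. M)) (\<lambda>x. \<lambda>i\<in>I. x (\<pi> i)) = PiM I (\<lambda>_. M)"
proof -
  interpret M: sigma_finite_measure M by fact
  interpret PM: product_sigma_finite "\<lambda>_. M" by standard
  have in_I: "\<pi> i \<in> I" if "i \<in> I" for i using that \<pi> by (simp add: permutes_in_image)
  have m[measurable]: "(\<lambda>x. \<lambda>i\<in>I. x (\<pi> i)) \<in> measurable (PiM I (\<lambda>_. M)) (PiM I (\<lambda>_. M))"
    using in_I by (intro measurable_restrict measurable_component_singleton)
  show ?thesis
  proof (rule PM.PiM_eqI[OF I])
    fix A :: "_ \<Rightarrow> _" assume A: "\<And>i. i \<in> I \<Longrightarrow> A i \<in> sets M"
    have inv: "inv_into UNIV \<pi> permutes I" using \<pi> by (rule permutes_inv)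
    \<comment> \<open>A box pulled back along a permutation of the coordinates is the box with its
      sides permuted by the inverse.\<close>
    have "(\<lambda>x. \<lambda>i\<in>I. x (\<pi> i)) -` Pi\<^sub>E I A \<inter> space (PiM I (\<lambda>_. M)) = Pi\<^sub>E I (\<lambda>i. A (inv_into UNIV \<pi> i))"
    proof (intro equalityI subsetI)
      fix x assume x: "x \<in> (\<lambda>x. \<lambda>i\<in>I. x (\<pi> i)) -` Pi\<^sub>E I A \<inter> space (PiM I (\<lambda>_. M))"
      then have *: "x (\<pi> i) \<in> A i" if "i \<in> I" for i using that by (simp add: PiE_iff)
      have "x j \<in> A (inv_into UNIV \<pi> j)" if "j \<in> I" for j
        using *[of "inv_into UNIV \<pi> j"] permutes_in_image[OF inv, of j] that permutes_inverses(1)[OF \<pi>] by simp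
      then show "x \<in> Pi\<^sub>E I (\<lambda>i. A (inv_into UNIV \<pi> i))" using x by (simp add: space_PiM PiE_iff)
    next
      fix x assume x: "x \<in> Pi\<^sub>E I (\<lambda>i. A (inv_into UNIV \<pi> i))"
      have xA: "x j \<in> A (inv_into UNIV \<pi> j)" if "j \<in> I" for j
        using x that by (rule PiE_mem)
      have "x (\<pi> i) \<in> A i" if "i \<in> I" for i
        using xA[OF in_I[OF that]] permutes_inverses(2)[OF \<pi>] by simp
      moreover have "x j \<in> space M" if "j \<in> I" for j
        using xA[OF that] sets.sets_into_space[OF A, of "inv_into UNIV \<pi> j"] permutes_in_image[OF inv, of j] that
        by blast
      moreover have "x \<in> extensional I" using x by (simp add: PiE_iff)
      ultimately show "x \<in> (\<lambda>x. \<lambda>i\<in>I. x (\<pi> i)) -` Pi\<^sub>E I A \<inter> space (PiM I (\<lambda>_. M))"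
        by (simp add: space_PiM PiE_iff)
    qed
    then have "emeasure (distr (PiM I (\<lambda>_. M)) (PiM I (\<lambda>_. M)) (\<lambda>x. \<lambda>i\<in>I. x (\<pi> i))) (Pi\<^sub>E I A)
        = emeasure (PiM I (\<lambda>_. M)) (Pi\<^sub>E I (\<lambda>i. A (inv_into UNIV \<pi> i)))"
      using I A by (subst emeasure_distr) (auto intro!: sets_PiM_I_finite)
    also have "\<dots> = (\<Prod>i\<in>I. emeasure M (A (inv_into UNIV \<pi> i)))"
      using I A inv by (intro PM.emeasure_PiM) (auto simp: permutes_in_image)
    also have "\<dots> = (\<Prod>i\<in>I. emeasure M (A i))"
      using prod.permute[OF inv, of "\<lambda>i. emeasure M (A i)"] by (simp add: comp_def)
    finally show "emeasure (distr (PiM I (\<lambda>_. M)) (PiM I (\<lambda>_. M)) (\<lambda>x. \<lambda>i\<in>I. x (\<pi> i))) (Pi\<^sub>E I A)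
        = (\<Prod>i\<in>I. emeasure M (A i))" .
  qed simp
qed

lemma integral_PiM_permute:
  fixes f :: "('i \<Rightarrow> 'a) \<Rightarrow> real"
  assumes I: "finite I" and M: "sigma_finite_measure M" and \<pi>: "\<pi> permutes I"
    and f: "f \<in> borel_measurable (PiM I (\<lambda>_. M))"
  shows "(\<integral>x. f (\<lambda>i\<in>I. x (\<pi> i)) \<partial>PiM I (\<lambda>_. M)) = (\<integral>x. f x \<partial>PiM I (\<lambda>_. M))"
proof -
  have in_I: "\<pi> i \<in> I" if "i \<in> I" for i using that \<pi> by (simp add: permutes_in_image)
  have m: "(\<lambda>x. \<lambda>i\<in>I. x (\<pi> i)) \<in> measurable (PiM I (\<lambda>_. M)) (PiM I (\<lambda>_. M))"
    using in_I by (intro measurable_restrict measurable_component_singleton)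
  show ?thesis
    using integral_distr[OF m f] distr_PiM_permute[OF I M \<pi>] by simp
qed

lemma AE_PiM_const:
  assumes I: "finite I" and M: "finite_measure M" and P: "AE x in M. P x"
  shows "AE x in PiM I (\<lambda>_. M). \<forall>i\<in>I. P (x i)"
proof -
  interpret M: finite_measure M by fact
  interpret PM: product_sigma_finite "\<lambda>_. M" by standard
  obtain Z where Z: "{x \<in> space M. \<not> P x} \<subseteq> Z" "emeasure M Z = 0" "Z \<in> sets M"
    using P by (rule AE_E)
  have "AE x in PiM I (\<lambda>_. M). P (x i)" if i: "i \<in> I" for i
  proof (rule AE_I)
    let ?B = "Pi\<^sub>E I (\<lambda>j. if j = i then Z else space M)"
    show "{x \<in> space (PiM I (\<lambda>_. M)). \<not> P (x i)} \<subseteq> ?B"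
      using Z i by (auto simp: space_PiM PiE_iff extensional_def)
    have "emeasure (PiM I (\<lambda>_. M)) ?B = (\<Prod>j\<in>I. emeasure M (if j = i then Z else space M))"
      using I Z by (intro PM.emeasure_PiM) auto
    also have "\<dots> = 0" using I i Z by (intro prod_zero) auto
    finally show "emeasure (PiM I (\<lambda>_. M)) ?B = 0" .
    show "?B \<in> sets (PiM I (\<lambda>_. M))" using I Z by (intro sets_PiM_I_finite) auto
  qed
  then show ?thesis using I by (simp add: AE_finite_all)
qed

lemma finite_measure_PiM_const:
  assumes I: "finite I" and M: "finite_measure M"
  shows "finite_measure (PiM I (\<lambda>_. M))"
proof
  interpret M: finite_measure M by fact
  interpret PM: product_sigma_finite "\<lambda>_. M" by standard
  show "emeasure (PiM I (\<lambda>_. M)) (space (PiM I (\<lambda>_. M))) \<noteq> \<infinity>"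
    using I by (simp add: space_PiM PM.emeasure_PiM ennreal_prod_eq_top power_eq_top_ennreal M.emeasure_finite)
qed

section \<open>The beta weight\<close>

definition beta_measure :: "real \<Rightarrow> real \<Rightarrow> real measure" where
  "beta_measure a b =
     density lborel (\<lambda>x. ennreal (indicator {0..1} x * (x powr (a - 1) * (1 - x) powr (b - 1))))"

lemma sets_beta_measure [measurable_cong, simp]: "sets (beta_measure a b) = sets borel"
  and space_beta_measure [simp]: "space (beta_measure a b) = UNIV"
  by (simp_all add: beta_measure_def)

lemma finite_measure_beta_measure:
  assumes "a > 0" "b > 0"
  shows "finite_measure (beta_measure a b)"
proof
  have "integrable lborel (\<lambda>x. indicator {0..1} x * (x powr (a - 1) * (1 - x) powr (b - 1)))"
    using integrable_Beta[OF assms] by (simp add: set_integrable_def)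
  from integrableD(2)[OF this]
  have "(\<integral>\<^sup>+x. ennreal (indicator {0..1} x * (x powr (a - 1) * (1 - x) powr (b - 1))) \<partial>lborel) \<noteq> \<infinity>"
    by simp
  then show "emeasure (beta_measure a b) (space (beta_measure a b)) \<noteq> \<infinity>"
    by (simp add: beta_measure_def emeasure_density)
qed

lemma AE_beta_measure: "AE x in beta_measure a b. 0 < x \<and> x < 1"
proof -
  have "AE x in lborel. x \<noteq> (0::real)" "AE x in lborel. x \<noteq> (1::real)"
    by (rule AE_lborel_singleton)+
  then show ?thesis
    unfolding beta_measure_def
    by (subst AE_density) (auto simp: indicator_def)
qed

text \<open>The parameter \<open>a\<close> moves by inserting a power of \<open>x\<close>. Three
  values of \<open>s\<close> occur later: 1 for the recurrence, \<open>2 * g\<close> for the removal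
  of a variable, and a difference of parameters for monotonicity in \<open>a\<close>.\<close>

lemma beta_measure_shift:
  "beta_measure (a + s) b = density (beta_measure a b) (\<lambda>x. ennreal (x powr s))"
proof -
  have *: "indicator {0..1} x * (x powr (a + s - 1) * (1 - x) powr (b - 1))
      = indicator {0..1} x * (x powr (a - 1) * (1 - x) powr (b - 1)) * x powr s" for x :: real
    by (simp add: powr_add[symmetric] algebra_simps)
  show ?thesis
    unfolding beta_measure_def
    by (subst density_density_eq) (auto simp: * ennreal_mult' intro!: density_cong)
qed

text \<open>\<open>F\<close> contains the weight, and a power such as x^a may fail to be
  differentiable at an endpoint; so continuity is asked for on [0,1] and the derivative only inside.
  Boundedness of \<open>h\<close> makes the integrand Lebesgue integrable, which identifies its
  integral with the gauge integral of the fundamental theorem.\<close>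

lemma integral_beta_measure_FTC:
  fixes F h :: "real \<Rightarrow> real"
  assumes ab: "a > 0" "b > 0" and F: "continuous_on {0..1} F"
    and F': "\<And>x. 0 < x \<Longrightarrow> x < 1 \<Longrightarrow>
      (F has_real_derivative x powr (a - 1) * (1 - x) powr (b - 1) * h x) (at x)"
    and h[measurable]: "h \<in> borel_measurable borel"
    and c: "\<And>x. 0 \<le> x \<Longrightarrow> x \<le> 1 \<Longrightarrow> \<bar>h x\<bar> \<le> c"
  shows "(\<integral>x. h x \<partial>beta_measure a b) = F 1 - F 0"
proof -
  let ?w = "\<lambda>x. x powr (a - 1) * (1 - x) powr (b - 1) :: real"
  have "set_integrable lborel {0..1} (\<lambda>x. ?w x * h x)"
    unfolding set_integrable_def
  proof (rule Bochner_Integration.integrable_bound)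
    show "integrable lborel (\<lambda>x. c * (indicator {0..1} x *\<^sub>R ?w x))"
      using integrable_Beta[OF ab] by (auto simp: set_integrable_def)
    show "AE x in lborel. norm (indicator {0..1} x *\<^sub>R (?w x * h x)) \<le> norm (c * (indicator {0..1} x *\<^sub>R ?w x))"
    proof (rule AE_I2)
      fix x :: real
      have "\<bar>?w x * h x\<bar> \<le> \<bar>c * ?w x\<bar>" if "x \<in> {0..1}"
        using c[of x] that by (auto simp: abs_mult mult.commute[of c] intro!: mult_left_mono)
      then show "norm (indicator {0..1} x *\<^sub>R (?w x * h x)) \<le> norm (c * (indicator {0..1} x *\<^sub>R ?w x))"
        by (auto simp: indicator_def)
    qed
  qed auto
  then have "(LINT x:{0..1}|lborel. ?w x * h x) = integral {0..1} (\<lambda>x. ?w x * h x)"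
    by (rule set_borel_integral_eq_integral(2))
  also have "\<dots> = F 1 - F 0"
    using F F'
    by (intro integral_unique fundamental_theorem_of_calculus_interior)
      (auto simp: has_real_derivative_iff_has_vector_derivative)
  finally have "(LINT x:{0..1}|lborel. ?w x * h x) = F 1 - F 0" .
  then show ?thesis
    unfolding beta_measure_def
    by (subst integral_real_density) (auto simp: set_lebesgue_integral_def mult_ac)
qed

section \<open>Powers of the Vandermonde product\<close>

abbreviation beta_PiM :: "nat \<Rightarrow> real \<Rightarrow> real \<Rightarrow> (nat \<Rightarrow> real) measure" where
  "beta_PiM N a b \<equiv> PiM {..<N} (\<lambda>_. beta_measure a b)"

lemma sets_beta_PiM [measurable_cong]: "sets (beta_PiM N a b) = sets (PiM {..<N} (\<lambda>_. borel))"
  by (intro sets_PiM_cong) auto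

lemma AE_beta_PiM:
  assumes "a > 0" "b > 0"
  shows "AE x in beta_PiM N a b. \<forall>i<N. 0 < x i \<and> x i < 1"
  using AE_PiM_const[OF _ finite_measure_beta_measure[OF assms] AE_beta_measure, of "{..<N}"]
  by (simp add: Ball_def)

lemma integrable_beta_PiM:
  fixes f :: "(nat \<Rightarrow> real) \<Rightarrow> real"
  assumes ab: "a > 0" "b > 0" and f: "f \<in> borel_measurable (PiM {..<N} (\<lambda>_. borel))"
    and c: "\<And>x. (\<And>i. i < N \<Longrightarrow> 0 < x i \<and> x i < 1) \<Longrightarrow> \<bar>f x\<bar> \<le> c"
  shows "integrable (beta_PiM N a b) f"
proof -
  interpret finite_measure "beta_PiM N a b"
    by (rule finite_measure_PiM_const[OF finite_lessThan finite_measure_beta_measure[OF ab]])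
  show ?thesis
  proof (rule integrable_const_bound)
    show "AE x in beta_PiM N a b. norm (f x) \<le> c"
      using AE_beta_PiM[OF ab, of N] by eventually_elim (use c in auto)
    show "f \<in> borel_measurable (beta_PiM N a b)"
      using f by (simp cong: measurable_cong_sets add: sets_beta_PiM)
  qed
qed

lemma integral_beta_PiM_shift:
  fixes f :: "(nat \<Rightarrow> real) \<Rightarrow> real"
  assumes ab: "a > 0" "b > 0" "a + s > 0" and f: "f \<in> borel_measurable (PiM {..<N} (\<lambda>_. borel))"
  shows "(\<integral>x. f x \<partial>beta_PiM N (a + s) b) = (\<integral>x. (\<Prod>i<N. x i powr s) * f x \<partial>beta_PiM N a b)"
proof -
  interpret B: finite_measure "beta_measure a b" by (rule finite_measure_beta_measure[OF ab(1,2)])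
  interpret B': finite_measure "beta_measure (a + s) b" by (rule finite_measure_beta_measure[OF ab(3,2)])
  have [measurable]: "f \<in> borel_measurable (beta_PiM N a b)"
    using f by (simp cong: measurable_cong_sets add: sets_beta_PiM)
  have "beta_PiM N (a + s) b = density (beta_PiM N a b) (\<lambda>x. \<Prod>i<N. ennreal (x i powr s))"
    unfolding beta_measure_shift
    by (rule PiM_density_const[OF finite_lessThan B.sigma_finite_measure_axioms
          B'.sigma_finite_measure_axioms[unfolded beta_measure_shift]]) simp
  also have "\<dots> = density (beta_PiM N a b) (\<lambda>x. ennreal (\<Prod>i<N. x i powr s))"
    by (simp add: prod_ennreal)
  finally show ?thesis
    by (simp add: integral_real_density prod_nonneg)
qed

lemma integral_beta_PiM_swap:
  fixes f :: "(nat \<Rightarrow> real) \<Rightarrow> real"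
  assumes ab: "a > 0" "b > 0" and f: "f \<in> borel_measurable (PiM {..<N} (\<lambda>_. borel))"
    and ij: "i < N" "j < N"
  shows "(\<integral>x. f (\<lambda>k\<in>{..<N}. x (Transposition.transpose i j k)) \<partial>beta_PiM N a b)
       = (\<integral>x. f x \<partial>beta_PiM N a b)"
proof (rule integral_PiM_permute)
  show "sigma_finite_measure (beta_measure a b)"
    using finite_measure_beta_measure[OF ab] by (rule finite_measure.axioms)
  show "f \<in> borel_measurable (beta_PiM N a b)"
    using f by (simp cong: measurable_cong_sets add: sets_beta_PiM)
qed (use ij in \<open>auto intro: permutes_swap_id\<close>)

text \<open>Both \<open>(i, j)\<close> and \<open>(j, i)\<close> occur, so \<open>vandermonde N 1\<close> is the square of the Vandermonde
  product.\<close>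

definition vandermonde :: "nat \<Rightarrow> real \<Rightarrow> (nat \<Rightarrow> real) \<Rightarrow> real" where
  "vandermonde N g x = (\<Prod>i<N. \<Prod>j\<in>{..<N} - {i}. \<bar>x i - x j\<bar> powr g)"

lemma vandermonde_nonneg [simp]: "0 \<le> vandermonde N g x"
  by (simp add: vandermonde_def prod_nonneg)

lemma vandermonde_cong: "(\<And>i. i < N \<Longrightarrow> x i = y i) \<Longrightarrow> vandermonde N g x = vandermonde N g y"
  by (auto simp: vandermonde_def intro!: prod.cong)

lemma measurable_vandermonde [measurable]: "vandermonde N g \<in> borel_measurable (PiM {..<N} (\<lambda>_. borel))"
  unfolding vandermonde_def by measurable

lemma vandermonde_0 [simp]: "vandermonde 0 g x = 1"
  by (simp add: vandermonde_def)

lemma vandermonde_Suc: "vandermonde (Suc m) g x = vandermonde m g x * (\<Prod>i<m. \<bar>x m - x i\<bar> powr (2 * g))"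
proof -
  let ?f = "\<lambda>i j. \<bar>x i - x j\<bar> powr g"
  have 1: "(\<Prod>j\<in>{..<Suc m} - {i}. ?f i j) = (\<Prod>j\<in>{..<m} - {i}. ?f i j) * ?f i m" if "i < m" for i
  proof -
    have "{..<Suc m} - {i} = insert m ({..<m} - {i})" using that by auto
    then show ?thesis by simp
  qed
  have 2: "{..<Suc m} - {m} = {..<m}" by auto
  have "vandermonde (Suc m) g x = (\<Prod>i<m. (\<Prod>j\<in>{..<m} - {i}. ?f i j) * ?f i m) * (\<Prod>j<m. ?f m j)"
    unfolding vandermonde_def by (simp add: 2) (simp add: 1)
  also have "\<dots> = vandermonde m g x * ((\<Prod>i<m. ?f i m) * (\<Prod>j<m. ?f m j))"
    by (simp add: vandermonde_def prod.distrib)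
  also have "(\<Prod>i<m. ?f i m) * (\<Prod>j<m. ?f m j) = (\<Prod>i<m. \<bar>x m - x i\<bar> powr (2 * g))"
    unfolding prod.distrib[symmetric]
    by (intro prod.cong) (auto simp: abs_minus_commute powr_add[symmetric])
  finally show ?thesis .
qed

lemma vandermonde_permute:
  assumes \<pi>: "\<pi> permutes {..<N}"
  shows "vandermonde N g (\<lambda>i\<in>{..<N}. x (\<pi> i)) = vandermonde N g x"
proof -
  have in_I: "\<pi> i < N \<longleftrightarrow> i < N" for i using permutes_in_image[OF \<pi>, of i] by simp
  have inj: "inj_on \<pi> A" for A using permutes_inj[OF \<pi>] by (rule inj_on_subset) simp
  have img: "\<pi> ` ({..<N} - {i}) = {..<N} - {\<pi> i}" for i
    using permutes_image[OF \<pi>] permutes_inj[OF \<pi>] by (simp add: image_set_diff)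
  have reidx: "(\<Prod>j\<in>{..<N} - {\<pi> i}. \<bar>x (\<pi> i) - x j\<bar> powr g)
      = (\<Prod>j\<in>{..<N} - {i}. \<bar>x (\<pi> i) - x (\<pi> j)\<bar> powr g)" for i
    using prod.reindex[OF inj, of "\<lambda>j. \<bar>x (\<pi> i) - x j\<bar> powr g" "{..<N} - {i}"]
    by (simp add: img comp_def)
  have "vandermonde N g (\<lambda>i\<in>{..<N}. x (\<pi> i)) = (\<Prod>i<N. \<Prod>j\<in>{..<N} - {i}. \<bar>x (\<pi> i) - x (\<pi> j)\<bar> powr g)"
    unfolding vandermonde_def by (intro prod.cong) auto
  also have "\<dots> = (\<Prod>i<N. \<Prod>j\<in>{..<N} - {\<pi> i}. \<bar>x (\<pi> i) - x j\<bar> powr g)"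
    by (simp only: reidx)
  also have "\<dots> = vandermonde N g x"
    unfolding vandermonde_def
    using prod.permute[OF \<pi>, of "\<lambda>i. \<Prod>j\<in>{..<N} - {i}. \<bar>x i - x j\<bar> powr g"] by (simp add: comp_def)
  finally show ?thesis .
qed

text \<open>This turns \<open>g\<close> into the exponent of one fixed function V, so that the
  derivative in \<open>g\<close> at 1 is V ln V.\<close>

lemma vandermonde_powr: "vandermonde N g x = vandermonde N 1 x powr g"
  unfolding vandermonde_def by (simp only: prod_powr_distrib powr_powr mult_1)

lemma vandermonde_le_1:
  assumes "g \<ge> 0" "\<And>i. i < N \<Longrightarrow> 0 < x i \<and> x i < 1"
  shows "vandermonde N g x \<le> 1"
  unfolding vandermonde_def
proof (intro prod_le_1 conjI prod_nonneg)
  fix i j assume "i \<in> {..<N}" "j \<in> {..<N} - {i}"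
  then have "\<bar>x i - x j\<bar> \<le> 1" using assms(2)[of i] assms(2)[of j] by auto
  then show "\<bar>x i - x j\<bar> powr g \<le> 1" using assms(1) by (intro powr_le1) auto
qed auto

text \<open>Since 0 powr g = 0, expressions with the factor V are 0 on the diagonal, where quotients
  by \<open>x i - x j\<close> and logarithms only have default values.\<close>

lemma vandermonde_eq_0:
  assumes "i < N" "j < N" "i \<noteq> j" "x i = x j"
  shows "vandermonde N g x = 0"
proof -
  have "\<exists>j\<in>{..<N} - {i}. \<bar>x i - x j\<bar> powr g = 0"
    using assms by (intro bexI[of _ j]) auto
  then have "(\<Prod>j\<in>{..<N} - {i}. \<bar>x i - x j\<bar> powr g) = 0"
    by (intro prod_zero) simp_all
  then have "\<exists>i\<in>{..<N}. (\<Prod>j\<in>{..<N} - {i}. \<bar>x i - x j\<bar> powr g) = 0"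
    using assms(1) by blast
  then show ?thesis
    unfolding vandermonde_def by (intro prod_zero) simp_all
qed

section \<open>The Selberg integral and the derivatives of its factors in one variable\<close>

definition selberg :: "nat \<Rightarrow> real \<Rightarrow> real \<Rightarrow> real \<Rightarrow> real" where
  "selberg N a b g = (\<integral>x. vandermonde N g x \<partial>beta_PiM N a b)"

text \<open>The quotient form carries the sign of \<open>y - c\<close> and, with 0 / 0 = 0, is also
  right at \<open>y = c\<close>. It already has the shape of the terms that are symmetrised in
  Aomoto's argument.\<close>

lemma has_real_derivative_abs_powr:
  fixes p c y :: real
  assumes "p > 1"
  shows "((\<lambda>y. \<bar>y - c\<bar> powr p) has_real_derivative p * (\<bar>y - c\<bar> powr p / (y - c))) (at y)"
proof -
  consider "y > c" | "y < c" | "y = c" by linarith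
  then show ?thesis
  proof cases
    case 1
    have "((\<lambda>y. (y - c) powr p) has_real_derivative p * (y - c) powr (p - 1)) (at y)"
      using 1 by (auto intro!: derivative_eq_intros)
    moreover have "eventually (\<lambda>y. (y - c) powr p = \<bar>y - c\<bar> powr p) (nhds y)"
      using eventually_nhds_in_open[of "{c<..}" y] 1 by (auto elim!: eventually_mono)
    ultimately have "((\<lambda>y. \<bar>y - c\<bar> powr p) has_real_derivative p * (y - c) powr (p - 1)) (at y)"
      by (simp only: DERIV_cong_ev[OF refl _ refl])
    then show ?thesis using 1 by (simp add: powr_diff)
  next
    case 2
    have "((\<lambda>y. (c - y) powr p) has_real_derivative p * (c - y) powr (p - 1) * (-1)) (at y)"
      using 2 by (auto intro!: derivative_eq_intros)
    moreover have "eventually (\<lambda>y. (c - y) powr p = \<bar>y - c\<bar> powr p) (nhds y)"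
      using eventually_nhds_in_open[of "{..<c}" y] 2 by (auto elim!: eventually_mono)
    ultimately have "((\<lambda>y. \<bar>y - c\<bar> powr p) has_real_derivative p * (c - y) powr (p - 1) * (-1)) (at y)"
      by (simp only: DERIV_cong_ev[OF refl _ refl])
    moreover have "p * (c - y) powr (p - 1) * (-1) = p * (\<bar>y - c\<bar> powr p / (y - c))"
      using 2 by (simp add: powr_diff field_simps)
    ultimately show ?thesis by simp
  next
    case 3
    \<comment> \<open>At \<open>y = c\<close> the difference quotient is |h|^p / h, of absolute
      value |h|^(p - 1); this is where \<open>p > 1\<close> enters.\<close>
    have "((\<lambda>h. \<bar>h\<bar> powr (p - 1)) \<longlongrightarrow> 0) (at (0::real))"
      using assms by (intro tendsto_eq_intros | simp)+
    then have "((\<lambda>h. \<bar>\<bar>h\<bar> powr p / h\<bar>) \<longlongrightarrow> 0) (at (0::real))"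
      by (rule Lim_transform_eventually)
        (auto simp: eventually_at_filter abs_divide powr_diff intro!: always_eventually)
    then have "((\<lambda>h. \<bar>h\<bar> powr p / h) \<longlongrightarrow> 0) (at (0::real))"
      by (rule tendsto_rabs_zero_cancel)
    then show ?thesis using 3 by (simp add: DERIV_def)
  qed
qed

text \<open>In quotient form the product rule restores the whole product in every numerator, so the
  formula for a logarithmic derivative stays valid at the zeros.\<close>

lemma has_real_derivative_prod_abs_powr:
  fixes p y :: real and x :: "nat \<Rightarrow> real"
  assumes "p > 1"
  shows "((\<lambda>y. \<Prod>i<m. \<bar>y - x i\<bar> powr p) has_real_derivative
           (\<Sum>j<m. p * ((\<Prod>i<m. \<bar>y - x i\<bar> powr p) / (y - x j)))) (at y)"
proof (induction m)
  case (Suc m)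
  show ?case
    using DERIV_mult[OF Suc has_real_derivative_abs_powr[OF assms, of "x m"]]
    by (simp add: sum_distrib_left sum_distrib_right mult_ac)
qed simp

text \<open>One power of |y - x_j| pays for the denominator; the exponent p - 1 that remains is
  positive and all distances are at most 1.\<close>

lemma prod_abs_powr_divide_le_1:
  fixes p y :: real and x :: "nat \<Rightarrow> real"
  assumes p: "p > 1" and y: "0 \<le> y" "y \<le> 1" and x: "\<And>i. i < m \<Longrightarrow> 0 < x i \<and> x i < 1" and j: "j < m"
  shows "\<bar>(\<Prod>i<m. \<bar>y - x i\<bar> powr p) / (y - x j)\<bar> \<le> 1"
proof (cases "y = x j")
  case False
  have "(\<Prod>i<m. \<bar>y - x i\<bar> powr p) / (y - x j)
      = (\<bar>y - x j\<bar> powr p / (y - x j)) * (\<Prod>i\<in>{..<m} - {j}. \<bar>y - x i\<bar> powr p)"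
    using j by (subst prod.remove[of _ j]) auto
  also have "\<bar>\<dots>\<bar> = \<bar>y - x j\<bar> powr (p - 1) * (\<Prod>i\<in>{..<m} - {j}. \<bar>y - x i\<bar> powr p)"
    using False by (simp add: abs_mult abs_divide powr_diff abs_prod)
  also have "\<dots> \<le> 1 * 1"
  proof (intro mult_mono prod_le_1 conjI)
    have *: "\<bar>y - x i\<bar> \<le> 1" if "i < m" for i using y x[OF that] by auto
    show "\<bar>y - x j\<bar> powr (p - 1) \<le> 1" using p *[OF j] by (intro powr_le1) auto
    show "\<bar>y - x i\<bar> powr p \<le> 1" if "i \<in> {..<m} - {j}" for i
      using p * that by (intro powr_le1) auto
  qed (auto intro: prod_nonneg)
  finally show ?thesis by simp
qed simp

lemma real_one_pos: "0 < (1 :: real)"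
  by simp

lemma measurable_vandermonde_quotient [measurable]:
  "i < N \<Longrightarrow> j < N \<Longrightarrow> (\<lambda>x. vandermonde N g x / (x i - x j)) \<in> borel_measurable (PiM {..<N} (\<lambda>_. borel))"
  by measurable

lemma vandermonde_quotient_le_1:
  assumes g: "g \<ge> 1" and x: "\<And>i. i < Suc m \<Longrightarrow> 0 < x i \<and> x i < 1" and j: "j < m"
  shows "\<bar>vandermonde (Suc m) g x / (x m - x j)\<bar> \<le> 1"
proof -
  have "\<bar>(\<Prod>i<m. \<bar>x m - x i\<bar> powr (2 * g)) / (x m - x j)\<bar> \<le> 1"
    using g x j less_imp_le[of 0 "x m"] less_imp_le[of "x m" 1] x[of m]
    by (intro prod_abs_powr_divide_le_1) auto
  moreover have "vandermonde m g x \<le> 1" using g x by (intro vandermonde_le_1) auto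
  ultimately have "vandermonde m g x * \<bar>(\<Prod>i<m. \<bar>x m - x i\<bar> powr (2 * g)) / (x m - x j)\<bar> \<le> 1 * 1"
    by (intro mult_mono) auto
  then show ?thesis by (simp add: vandermonde_Suc abs_mult abs_divide)
qed

section \<open>Integrability and integration by parts in the last variable\<close>

context
  fixes a b g :: real and m :: nat
  assumes ab: "a > 0" "b > 0" and g: "g \<ge> 1"
begin

lemma integrable_mult_vandermonde:
  assumes "f \<in> borel_measurable (PiM {..<Suc m} (\<lambda>_. borel))"
    and c: "\<And>x. (\<And>i. i < Suc m \<Longrightarrow> 0 < x i \<and> x i < 1) \<Longrightarrow> \<bar>f x\<bar> \<le> c"
  shows "integrable (beta_PiM (Suc m) a b) (\<lambda>x. f x * vandermonde (Suc m) g x)"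
proof (rule integrable_beta_PiM[OF ab])
  fix x :: "nat \<Rightarrow> real" assume x: "\<And>i. i < Suc m \<Longrightarrow> 0 < x i \<and> x i < 1"
  have fc: "\<bar>f x\<bar> \<le> c" using x by (rule c)
  then have c0: "0 \<le> c" using abs_ge_zero order_trans by blast
  have "\<bar>f x\<bar> * vandermonde (Suc m) g x \<le> c * 1"
    using fc c0 vandermonde_le_1[of g "Suc m" x] g x by (intro mult_mono) auto
  then show "\<bar>f x * vandermonde (Suc m) g x\<bar> \<le> c" by (simp add: abs_mult)
qed (use assms(1) in measurable)

lemma integrable_mult_vandermonde_quotient:
  assumes "f \<in> borel_measurable (PiM {..<Suc m} (\<lambda>_. borel))" and j: "j < m"
    and c: "\<And>x. (\<And>i. i < Suc m \<Longrightarrow> 0 < x i \<and> x i < 1) \<Longrightarrow> \<bar>f x\<bar> \<le> c"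
  shows "integrable (beta_PiM (Suc m) a b) (\<lambda>x. f x * (vandermonde (Suc m) g x / (x m - x j)))"
proof (rule integrable_beta_PiM[OF ab])
  fix x :: "nat \<Rightarrow> real" assume x: "\<And>i. i < Suc m \<Longrightarrow> 0 < x i \<and> x i < 1"
  have fc: "\<bar>f x\<bar> \<le> c" using x by (rule c)
  then have c0: "0 \<le> c" using abs_ge_zero order_trans by blast
  have "\<bar>f x\<bar> * \<bar>vandermonde (Suc m) g x / (x m - x j)\<bar> \<le> c * 1"
    using fc c0 vandermonde_quotient_le_1[OF g x j] by (intro mult_mono abs_ge_zero) auto
  then show "\<bar>f x * (vandermonde (Suc m) g x / (x m - x j))\<bar> \<le> c" by (simp add: abs_mult)
next
  show "(\<lambda>x. f x * (vandermonde (Suc m) g x / (x m - x j))) \<in> borel_measurable (PiM {..<Suc m} (\<lambda>_. borel))"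
    using j by (intro borel_measurable_times assms(1) measurable_vandermonde_quotient) auto
qed

lemma integral_beta_PiM_Suc:
  fixes f :: "(nat \<Rightarrow> real) \<Rightarrow> real"
  assumes "integrable (beta_PiM (Suc m) a b) f"
  shows "(\<integral>x. f x \<partial>beta_PiM (Suc m) a b) = (\<integral>x. (\<integral>y. f (x(m := y)) \<partial>beta_measure a b) \<partial>beta_PiM m a b)"
proof -
  interpret B: finite_measure "beta_measure a b" by (rule finite_measure_beta_measure[OF ab])
  interpret PM: product_sigma_finite "\<lambda>_. beta_measure a b" by standard
  show ?thesis
    using PM.product_integral_insert[of "{..<m}" m f] assms by (simp add: lessThan_Suc)
qed

text \<open>The integrand times the weight is the derivative of y^a (1 - y)^b G(y), which vanishes
  at both ends because \<open>a\<close> and \<open>b\<close> are positive.\<close>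

lemma integral_ibp_interior:
  fixes x :: "nat \<Rightarrow> real"
  assumes x: "\<And>i. i < m \<Longrightarrow> 0 < x i \<and> x i < 1"
  defines "G \<equiv> \<lambda>y. \<Prod>i<m. \<bar>y - x i\<bar> powr (2 * g)"
  shows "(\<integral>y. (a - (a + b) * y) * G y + y * (1 - y) * (\<Sum>j<m. 2 * g * (G y / (y - x j))) \<partial>beta_measure a b) = 0"
proof -
  let ?F = "\<lambda>y. y powr a * (1 - y) powr b * G y"
  have G': "(G has_real_derivative (\<Sum>j<m. 2 * g * (G y / (y - x j)))) (at y)" for y
    unfolding G_def using g by (intro has_real_derivative_prod_abs_powr) auto
  have contG: "continuous_on UNIV G"
    using G' by (intro continuous_at_imp_continuous_on ballI DERIV_isCont)
  have G1: "\<bar>G y\<bar> \<le> 1" if "0 \<le> y" "y \<le> 1" for y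
  proof -
    have "\<bar>y - x i\<bar> powr (2 * g) \<le> 1" if "i < m" for i
      using \<open>0 \<le> y\<close> \<open>y \<le> 1\<close> x[OF that] g by (intro powr_le1) auto
    then show ?thesis by (auto simp: G_def abs_prod intro!: prod_le_1)
  qed
  have Gq: "\<bar>G y / (y - x j)\<bar> \<le> 1" if "0 \<le> y" "y \<le> 1" "j < m" for y j
    unfolding G_def using g x that by (intro prod_abs_powr_divide_le_1) auto
  have "(\<integral>y. (a - (a + b) * y) * G y + y * (1 - y) * (\<Sum>j<m. 2 * g * (G y / (y - x j))) \<partial>beta_measure a b)
      = ?F 1 - ?F 0"
  proof (rule integral_beta_measure_FTC[OF ab])
    show "continuous_on {0..1} ?F"
      using ab by (intro continuous_on_mult continuous_on_powr' continuous_on_subset[OF contG]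
          continuous_intros) auto
    show "(?F has_real_derivative y powr (a - 1) * (1 - y) powr (b - 1) *
        ((a - (a + b) * y) * G y + y * (1 - y) * (\<Sum>j<m. 2 * g * (G y / (y - x j))))) (at y)"
      if y: "0 < y" "y < 1" for y
    proof -
      have pa: "y powr a = y powr (a - 1) * y" and pb: "(1 - y) powr b = (1 - y) powr (b - 1) * (1 - y)"
        using y by (simp_all add: powr_diff)
      have "(?F has_real_derivative (a * y powr (a - 1) * (1 - y) powr b - y powr a * (b * (1 - y) powr (b - 1))) * G y
          + y powr a * (1 - y) powr b * (\<Sum>j<m. 2 * g * (G y / (y - x j)))) (at y)"
        using y by (auto intro!: derivative_eq_intros G' simp: algebra_simps)
      then show ?thesis
        unfolding pa pb by (rule DERIV_cong) (simp add: algebra_simps)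
    qed
    show "(\<lambda>y. (a - (a + b) * y) * G y + y * (1 - y) * (\<Sum>j<m. 2 * g * (G y / (y - x j)))) \<in> borel_measurable borel"
      unfolding G_def by measurable
    show "\<bar>(a - (a + b) * y) * G y + y * (1 - y) * (\<Sum>j<m. 2 * g * (G y / (y - x j)))\<bar>
        \<le> (a + (a + b)) * 1 + 1 * (\<Sum>j<m. 2 * g * 1)" if y: "0 \<le> y" "y \<le> 1" for y
    proof -
      have "0 \<le> (a + b) * y" "(a + b) * y \<le> a + b"
        using y ab by (auto intro: mult_left_le)
      then have "\<bar>a - (a + b) * y\<bar> \<le> a + (a + b)" using ab by linarith
      then have "\<bar>(a - (a + b) * y) * G y\<bar> \<le> (a + (a + b)) * 1"
        unfolding abs_mult using G1[OF y] ab by (intro mult_mono) auto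
      moreover have "\<bar>y * (1 - y) * (\<Sum>j<m. 2 * g * (G y / (y - x j)))\<bar> \<le> 1 * (\<Sum>j<m. 2 * g * 1)"
        unfolding abs_mult[of "y * (1 - y)"]
      proof (intro mult_mono)
        show "\<bar>y * (1 - y)\<bar> \<le> 1" using y by (auto simp: abs_mult intro!: mult_le_one)
        show "\<bar>\<Sum>j<m. 2 * g * (G y / (y - x j))\<bar> \<le> (\<Sum>j<m. 2 * g * 1)"
          using Gq[OF y] g by (intro sum_abs[THEN order_trans] sum_mono)
            (simp only: abs_mult[of "2 * g"], intro mult_mono, auto)
      qed auto
      ultimately show ?thesis by linarith
    qed
  qed
  also have "\<dots> = 0" using ab by simp
  finally show ?thesis .
qed

end

text \<open>For \<open>a = 1\<close> the weight is (1 - y)^(b - 1), so (1 - y)^b G(y), without a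
  factor y, can serve as the antiderivative. Its value at 0 survives, and this boundary term is what
  removes one variable in \<open>selberg_pin\<close>.\<close>

lemma integral_ibp_boundary:
  fixes x :: "nat \<Rightarrow> real"
  assumes b: "b > 0" and g: "g \<ge> 1" and x: "\<And>i. i < m \<Longrightarrow> 0 < x i \<and> x i < 1"
  defines "G \<equiv> \<lambda>y. \<Prod>i<m. \<bar>y - x i\<bar> powr (2 * g)"
  shows "(\<integral>y. - b * G y + (1 - y) * (\<Sum>j<m. 2 * g * (G y / (y - x j))) \<partial>beta_measure 1 b) = - G 0"
proof -
  let ?F = "\<lambda>y. (1 - y) powr b * G y"
  have G': "(G has_real_derivative (\<Sum>j<m. 2 * g * (G y / (y - x j)))) (at y)" for y
    unfolding G_def using g by (intro has_real_derivative_prod_abs_powr) auto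
  have contG: "continuous_on UNIV G"
    using G' by (intro continuous_at_imp_continuous_on ballI DERIV_isCont)
  have G1: "\<bar>G y\<bar> \<le> 1" if "0 \<le> y" "y \<le> 1" for y
  proof -
    have "\<bar>y - x i\<bar> powr (2 * g) \<le> 1" if "i < m" for i
      using \<open>0 \<le> y\<close> \<open>y \<le> 1\<close> x[OF that] g by (intro powr_le1) auto
    then show ?thesis by (auto simp: G_def abs_prod intro!: prod_le_1)
  qed
  have Gq: "\<bar>G y / (y - x j)\<bar> \<le> 1" if "0 \<le> y" "y \<le> 1" "j < m" for y j
    unfolding G_def using g x that by (intro prod_abs_powr_divide_le_1) auto
  have "(\<integral>y. - b * G y + (1 - y) * (\<Sum>j<m. 2 * g * (G y / (y - x j))) \<partial>beta_measure 1 b) = ?F 1 - ?F 0"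
  proof (rule integral_beta_measure_FTC[OF real_one_pos b])
    show "continuous_on {0..1} ?F"
      using b by (intro continuous_on_mult continuous_on_powr' continuous_on_subset[OF contG]
          continuous_intros) auto
    show "(?F has_real_derivative y powr (1 - 1) * (1 - y) powr (b - 1) *
        (- b * G y + (1 - y) * (\<Sum>j<m. 2 * g * (G y / (y - x j))))) (at y)"
      if y: "0 < y" "y < 1" for y
    proof -
      have pb: "(1 - y) powr b = (1 - y) powr (b - 1) * (1 - y)"
        using y by (simp add: powr_diff)
      have "(?F has_real_derivative - (b * (1 - y) powr (b - 1)) * G y
          + (1 - y) powr b * (\<Sum>j<m. 2 * g * (G y / (y - x j)))) (at y)"
        using y by (auto intro!: derivative_eq_intros G' simp: algebra_simps)
      then show ?thesis
        unfolding pb using y by (elim DERIV_cong) (simp add: algebra_simps)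
    qed
    show "(\<lambda>y. - b * G y + (1 - y) * (\<Sum>j<m. 2 * g * (G y / (y - x j)))) \<in> borel_measurable borel"
      unfolding G_def by measurable
    show "\<bar>- b * G y + (1 - y) * (\<Sum>j<m. 2 * g * (G y / (y - x j)))\<bar>
        \<le> b * 1 + 1 * (\<Sum>j<m. 2 * g * 1)" if y: "0 \<le> y" "y \<le> 1" for y
    proof -
      have "\<bar>- b * G y\<bar> \<le> b * 1"
        unfolding abs_mult using G1[OF y] b by (intro mult_mono) auto
      moreover have "\<bar>(1 - y) * (\<Sum>j<m. 2 * g * (G y / (y - x j)))\<bar> \<le> 1 * (\<Sum>j<m. 2 * g * 1)"
        unfolding abs_mult[of "1 - y"]
      proof (intro mult_mono)
        show "\<bar>1 - y\<bar> \<le> 1" using y by auto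
        show "\<bar>\<Sum>j<m. 2 * g * (G y / (y - x j))\<bar> \<le> (\<Sum>j<m. 2 * g * 1)"
          using Gq[OF y] g by (intro sum_abs[THEN order_trans] sum_mono)
            (simp only: abs_mult[of "2 * g"], intro mult_mono, auto)
      qed auto
      ultimately show ?thesis by linarith
    qed
  qed
  also have "\<dots> = - G 0" using b by simp
  finally show ?thesis .
qed

section \<open>Aomoto's recurrence\<close>

lemma vandermonde_fun_upd:
  "vandermonde (Suc m) g (x(m := y)) = vandermonde m g x * (\<Prod>i<m. \<bar>y - x i\<bar> powr (2 * g))"
proof -
  have "vandermonde m g (x(m := y)) = vandermonde m g x" by (rule vandermonde_cong) simp
  then show ?thesis by (simp add: vandermonde_Suc)
qed

lemma abs_prod_le_1:
  fixes x :: "nat \<Rightarrow> real"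
  assumes "\<And>i. i < N \<Longrightarrow> 0 < x i \<and> x i < 1" "k \<le> N"
  shows "\<bar>\<Prod>i<k. x i\<bar> \<le> 1"
  using assms by (auto simp: abs_prod intro!: prod_le_1) (smt (verit) order.strict_trans2)+

lemma measurable_component_real:
  "j < N \<Longrightarrow> (\<lambda>x. x j :: real) \<in> borel_measurable (PiM {..<N} (\<lambda>_. borel))"
  by (intro measurable_component_singleton) auto

lemma measurable_prod_components:
  "k \<le> N \<Longrightarrow> (\<lambda>x. \<Prod>i<(k::nat). x i :: real) \<in> borel_measurable (PiM {..<N} (\<lambda>_. borel))"
  by (intro borel_measurable_prod measurable_component_real) auto

lemmas moment_measurable = borel_measurable_times borel_measurable_diff borel_measurable_const
  measurable_prod_components measurable_component_real measurable_vandermonde measurable_vandermonde_quotient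

lemma vandermonde_swap_last:
  "j < Suc m \<Longrightarrow> vandermonde (Suc m) g (\<lambda>k\<in>{..<Suc m}. x (Transposition.transpose m j k)) = vandermonde (Suc m) g x"
  by (rule vandermonde_permute) (auto intro: permutes_swap_id)

lemma prod_swap_last_ge:
  fixes x :: "nat \<Rightarrow> real"
  assumes "k \<le> j" "j \<le> m"
  shows "(\<Prod>i<k. (\<lambda>k\<in>{..<Suc m}. x (Transposition.transpose m j k)) i) = (\<Prod>i<k. x i)"
  using assms by (intro prod.cong) (auto simp: Transposition.transpose_def)

lemma prod_swap_last_less:
  fixes x :: "nat \<Rightarrow> real"
  assumes "j < k" "k \<le> m"
  shows "(\<Prod>i<k. (\<lambda>k\<in>{..<Suc m}. x (Transposition.transpose m j k)) i) = (\<Prod>i\<in>{..<k} - {j}. x i) * x m"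
proof -
  have "(\<Prod>i<k. (\<lambda>k\<in>{..<Suc m}. x (Transposition.transpose m j k)) i)
      = (\<Prod>i<k. x (Transposition.transpose m j i))"
    using assms by (intro prod.cong) auto
  also have "\<dots> = x m * (\<Prod>i\<in>{..<k} - {j}. x (Transposition.transpose m j i))"
    using assms by (subst prod.remove[of _ j]) auto
  also have "(\<Prod>i\<in>{..<k} - {j}. x (Transposition.transpose m j i)) = (\<Prod>i\<in>{..<k} - {j}. x i)"
    using assms by (intro prod.cong) (auto simp: Transposition.transpose_def)
  finally show ?thesis by simp
qed

lemma integral_swap_last:
  assumes ab: "a > 0" "b > 0" and f: "f \<in> borel_measurable (PiM {..<Suc m} (\<lambda>_. borel))" and j: "j < Suc m"
  shows "(\<integral>x. f (\<lambda>k\<in>{..<Suc m}. x (Transposition.transpose m j k)) \<partial>beta_PiM (Suc m) a b) = (\<integral>x. (f x :: real) \<partial>beta_PiM (Suc m) a b)"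
  using integral_beta_PiM_swap[OF ab f, of m j] j by simp

text \<open>The inner integral will be known only almost everywhere; replacing it under the outer
  integral requires its measurability.\<close>

lemma measurable_integral_fun_upd:
  fixes f :: "(nat \<Rightarrow> real) \<Rightarrow> real"
  assumes ab: "a > 0" "b > 0" and f: "f \<in> borel_measurable (PiM {..<Suc m} (\<lambda>_. borel))"
  shows "(\<lambda>x. \<integral>y. f (x(m := y)) \<partial>beta_measure a b) \<in> borel_measurable (beta_PiM m a b)"
proof -
  interpret finite_measure "beta_measure a b" by (rule finite_measure_beta_measure[OF ab])
  have "f \<in> borel_measurable (PiM (insert m {..<m}) (\<lambda>_. beta_measure a b))"
    using f by (simp cong: measurable_cong_sets add: sets_beta_PiM flip: lessThan_Suc)
  from measurable_comp[OF measurable_add_dim this]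
  show ?thesis
    by (intro borel_measurable_lebesgue_integral) (simp add: comp_def case_prod_unfold)
qed

section \<open>Moments, exchange of two variables and the recurrence\<close>

context
  fixes a b g :: real and m :: nat
  assumes ab: "a > 0" "b > 0" and g: "g \<ge> 1"
begin

private abbreviation "V \<equiv> vandermonde (Suc m) g"
private abbreviation "B \<equiv> beta_PiM (Suc m) a b"

lemma integrable_moment:
  "k \<le> Suc m \<Longrightarrow> integrable B (\<lambda>x. (\<Prod>i<k. x i) * V x)"
  by (rule integrable_mult_vandermonde[OF ab g, where c = 1]) (auto intro: abs_prod_le_1)

lemma integrable_moment':
  assumes k: "k \<le> Suc m" and j: "j < Suc m"
  shows "integrable B (\<lambda>x. (\<Prod>i<k. x i) * x j * V x)"
proof (rule integrable_mult_vandermonde[OF ab g, where c = 1])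
  fix x :: "nat \<Rightarrow> real" assume x: "\<And>i. i < Suc m \<Longrightarrow> 0 < x i \<and> x i < 1"
  show "\<bar>(\<Prod>i<k. x i) * x j\<bar> \<le> 1"
    unfolding abs_mult using abs_prod_le_1[OF x k] x[OF j] by (intro mult_le_one) auto
qed (use k j in \<open>intro moment_measurable; simp\<close>)

lemma integrable_quotient:
  assumes k: "k \<le> m" and j: "j < m"
  shows "integrable B (\<lambda>x. (\<Prod>i<k. x i) * (x m * (1 - x m)) * (V x / (x m - x j)))"
proof (rule integrable_mult_vandermonde_quotient[OF ab g _ j, where c = 1])
  fix x :: "nat \<Rightarrow> real" assume x: "\<And>i. i < Suc m \<Longrightarrow> 0 < x i \<and> x i < 1"
  have "\<bar>x m * (1 - x m)\<bar> \<le> 1" using x[of m] by (auto simp: abs_mult intro!: mult_le_one)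
  then show "\<bar>(\<Prod>i<k. x i) * (x m * (1 - x m))\<bar> \<le> 1"
    unfolding abs_mult[of "prod x _"] using abs_prod_le_1[OF x, of k] k by (intro mult_le_one) auto
qed (use k in \<open>intro moment_measurable; simp\<close>)

text \<open>The variables from index \<open>k\<close> on do not occur in the product, so they are
  interchangeable. The case \<open>j = k\<close> turns an extra factor \<open>x m\<close> into the
  next moment.\<close>

lemma moment_last:
  assumes k: "k \<le> j" "j \<le> m"
  shows "(\<integral>x. (\<Prod>i<k. x i) * x j * V x \<partial>B) = (\<integral>x. (\<Prod>i<k. x i) * x m * V x \<partial>B)"
proof -
  have "(\<integral>x. (\<Prod>i<k. x i) * x j * V x \<partial>B) =
     (\<integral>x. (\<lambda>x. (\<Prod>i<k. x i) * x m * V x) (\<lambda>k\<in>{..<Suc m}. x (Transposition.transpose m j k)) \<partial>B)"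
    using k by (intro Bochner_Integration.integral_cong refl)
       (simp only: prod_swap_last_ge vandermonde_swap_last less_Suc_eq_le, simp add: less_Suc_eq_le)
  also have "\<dots> = (\<integral>x. (\<Prod>i<k. x i) * x m * V x \<partial>B)"
    using k by (intro integral_swap_last ab) ((intro moment_measurable; simp), simp)
  finally show ?thesis .
qed

text \<open>Exchange \<open>x m\<close> with \<open>x j\<close> and add. As \<open>x j\<close>
  already occurs in the product, x_j x_m V is a common factor, and what is left is ((1 - x_m) - (1 -
  x_j)) / (x_m - x_j) = -1.\<close>

lemma moment_quotient_less:
  assumes jk: "j < k" "k \<le> m"
  shows "2 * (\<integral>x. (\<Prod>i<k. x i) * (x m * (1 - x m)) * (V x / (x m - x j)) \<partial>B)
       = - (\<integral>x. (\<Prod>i<k. x i) * x m * V x \<partial>B)"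
proof -
  let ?f = "\<lambda>x. (\<Prod>i<k. x i) * (x m * (1 - x m)) * (V x / (x m - x j))"
  let ?s = "\<lambda>x. \<lambda>k\<in>{..<Suc m}. x (Transposition.transpose m j k)"
  have j: "j < m" using jk by simp
  have int: "integrable B ?f" using jk by (intro integrable_quotient) auto
  have meas: "?f \<in> borel_measurable (PiM {..<Suc m} (\<lambda>_. borel))"
    using j jk by (intro moment_measurable; simp)
  have swap: "?f (?s x) = - (\<Prod>i<k. x i) * x m * V x - ?f x" for x
  proof (cases "x m = x j")
    case True
    then have "V x = 0" using j by (intro vandermonde_eq_0[of m _ j]) auto
    then show ?thesis using j by (simp add: vandermonde_swap_last del: restrict_apply)
  next
    case False
    have P: "(\<Prod>i<k. x i) = (\<Prod>i\<in>{..<k} - {j}. x i) * x j"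
      using jk by (subst prod.remove[of _ j]) auto
    have s: "?s x m = x j" "?s x j = x m" using j by auto
    show ?thesis
      unfolding prod_swap_last_less[OF jk] s vandermonde_swap_last[OF less_SucI[OF j]] P
      using False by (simp add: divide_simps) (simp add: algebra_simps)
  qed
  have "(\<integral>x. ?f x \<partial>B) = (\<integral>x. ?f (?s x) \<partial>B)"
    using integral_swap_last[OF ab meas, of j] j by simp
  also have "\<dots> = (\<integral>x. - ((\<Prod>i<k. x i) * x m * V x) - ?f x \<partial>B)"
    by (simp only: swap) (simp add: algebra_simps)
  also have "\<dots> = - (\<integral>x. (\<Prod>i<k. x i) * x m * V x \<partial>B) - (\<integral>x. ?f x \<partial>B)"
    using integrable_moment'[of k m] jk
    by (subst Bochner_Integration.integral_diff[OF _ int]) auto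
  finally show ?thesis by simp
qed

text \<open>Now \<open>x j\<close> is absent from the product, and the same exchange leaves (x_m (1
  - x_m) - x_j (1 - x_j)) / (x_m - x_j) = 1 - x_m - x_j. The two moments with one extra factor agree
  by \<open>moment_last\<close>.\<close>

lemma moment_quotient_ge:
  assumes jk: "k \<le> j" "j < m"
  shows "2 * (\<integral>x. (\<Prod>i<k. x i) * (x m * (1 - x m)) * (V x / (x m - x j)) \<partial>B)
       = (\<integral>x. (\<Prod>i<k. x i) * V x \<partial>B) - 2 * (\<integral>x. (\<Prod>i<k. x i) * x m * V x \<partial>B)"
proof -
  let ?f = "\<lambda>x. (\<Prod>i<k. x i) * (x m * (1 - x m)) * (V x / (x m - x j))"
  let ?s = "\<lambda>x. \<lambda>k\<in>{..<Suc m}. x (Transposition.transpose m j k)"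
  have j: "j < m" using jk by simp
  have int: "integrable B ?f" using jk by (intro integrable_quotient) auto
  have meas: "?f \<in> borel_measurable (PiM {..<Suc m} (\<lambda>_. borel))"
    using j jk by (intro moment_measurable; simp)
  have swap: "?f (?s x) = ((\<Prod>i<k. x i) * V x - (\<Prod>i<k. x i) * x m * V x - (\<Prod>i<k. x i) * x j * V x) - ?f x" for x
  proof (cases "x m = x j")
    case True
    then have "V x = 0" using j by (intro vandermonde_eq_0[of m _ j]) auto
    then show ?thesis using j by (simp add: vandermonde_swap_last del: restrict_apply)
  next
    case False
    have s: "?s x m = x j" "?s x j = x m" using j by auto
    show ?thesis
      unfolding prod_swap_last_ge[OF jk(1) less_imp_le[OF j]] s vandermonde_swap_last[OF less_SucI[OF j]]
      using False by (simp add: divide_simps) (simp add: algebra_simps)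
  qed
  have "(\<integral>x. ?f x \<partial>B) = (\<integral>x. ?f (?s x) \<partial>B)"
    using integral_swap_last[OF ab meas, of j] j by simp
  also have "\<dots> = (\<integral>x. ((\<Prod>i<k. x i) * V x - (\<Prod>i<k. x i) * x m * V x - (\<Prod>i<k. x i) * x j * V x) - ?f x \<partial>B)"
    by (simp only: swap)
  also have "\<dots> = ((\<integral>x. (\<Prod>i<k. x i) * V x \<partial>B) - (\<integral>x. (\<Prod>i<k. x i) * x m * V x \<partial>B)
      - (\<integral>x. (\<Prod>i<k. x i) * x j * V x \<partial>B)) - (\<integral>x. ?f x \<partial>B)"
  proof -
    have 1: "integrable B (\<lambda>x. (\<Prod>i<k. x i) * V x)" and 2: "integrable B (\<lambda>x. (\<Prod>i<k. x i) * x m * V x)"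
      and 3: "integrable B (\<lambda>x. (\<Prod>i<k. x i) * x j * V x)"
      using jk by (auto intro: integrable_moment integrable_moment')
    note 12 = Bochner_Integration.integrable_diff[OF 1 2]
    show ?thesis
      by (simp only: Bochner_Integration.integral_diff[OF Bochner_Integration.integrable_diff[OF 12 3] int]
         Bochner_Integration.integral_diff[OF 12 3] Bochner_Integration.integral_diff[OF 1 2])
  qed
  also have "(\<integral>x. (\<Prod>i<k. x i) * x j * V x \<partial>B) = (\<integral>x. (\<Prod>i<k. x i) * x m * V x \<partial>B)"
    using jk by (intro moment_last) auto
  finally show ?thesis by simp
qed

text \<open>Fubini integrates over \<open>x m\<close> first. As \<open>k \<le> m\<close>, neither
  the product nor the Vandermonde power of the first \<open>m\<close> variables involves
  \<open>x m\<close>; both leave the inner integral, which is zero by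
  \<open>integral_ibp_interior\<close>.\<close>

lemma moment_ibp:
  assumes k: "k \<le> m"
  shows "a * (\<integral>x. (\<Prod>i<k. x i) * V x \<partial>B) - (a + b) * (\<integral>x. (\<Prod>i<k. x i) * x m * V x \<partial>B)
     + 2 * g * (\<Sum>j<m. \<integral>x. (\<Prod>i<k. x i) * (x m * (1 - x m)) * (V x / (x m - x j)) \<partial>B) = 0"
proof -
  let ?q = "\<lambda>x. \<Prod>i<k. x i :: real"
  let ?T = "\<lambda>j x. ?q x * (x m * (1 - x m)) * (V x / (x m - x j))"
  let ?f = "\<lambda>x. a * (?q x * V x) - (a + b) * (?q x * x m * V x) + 2 * g * (\<Sum>j<m. ?T j x)"
  have int1: "integrable B (\<lambda>x. a * (?q x * V x))"
    using k by (intro integrable_mult_right integrable_moment) auto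
  have int2: "integrable B (\<lambda>x. (a + b) * (?q x * x m * V x))"
    using k by (intro integrable_mult_right integrable_moment') auto
  have intT: "integrable B (?T j)" if "j < m" for j
    using k that by (rule integrable_quotient)
  then have int3: "integrable B (\<lambda>x. 2 * g * (\<Sum>j<m. ?T j x))"
    by (intro integrable_mult_right Bochner_Integration.integrable_sum) auto
  note int12 = Bochner_Integration.integrable_diff[OF int1 int2]
  have "(\<integral>x. ?f x \<partial>B) = (\<integral>x. (\<integral>y. ?f (x(m := y)) \<partial>beta_measure a b) \<partial>beta_PiM m a b)"
    by (rule integral_beta_PiM_Suc[OF ab g Bochner_Integration.integrable_add[OF int12 int3]])
  also have "\<dots> = 0"
  proof (rule integral_eq_zero_AE)
    show "AE x in beta_PiM m a b. (\<integral>y. ?f (x(m := y)) \<partial>beta_measure a b) = 0"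
      using AE_beta_PiM[OF ab, of m]
    proof eventually_elim
      fix x :: "nat \<Rightarrow> real" assume x: "\<forall>i<m. 0 < x i \<and> x i < 1"
      define G where "G y = (\<Prod>i<m. \<bar>y - x i\<bar> powr (2 * g))" for y
      have q: "?q (x(m := y)) = ?q x" for y using k by (intro prod.cong) auto
      have "?f (x(m := y)) = (?q x * vandermonde m g x) *
          ((a - (a + b) * y) * G y + y * (1 - y) * (\<Sum>j<m. 2 * g * (G y / (y - x j))))" for y
      proof -
        define S where "S = (\<Sum>j<m. 2 * g * (G y / (y - x j)))"
        have eq: "2 * g * (\<Sum>j<m. ?T j (x(m := y))) = ?q x * vandermonde m g x * (y * (1 - y) * S)"
          unfolding q vandermonde_fun_upd G_def[symmetric] S_def sum_distrib_left
          by (intro sum.cong) auto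
        show ?thesis
          unfolding S_def[symmetric] eq unfolding q vandermonde_fun_upd G_def[symmetric] fun_upd_same
          by (simp add: algebra_simps)
      qed
      then have "(\<integral>y. ?f (x(m := y)) \<partial>beta_measure a b) = (?q x * vandermonde m g x) *
          (\<integral>y. (a - (a + b) * y) * G y + y * (1 - y) * (\<Sum>j<m. 2 * g * (G y / (y - x j))) \<partial>beta_measure a b)"
        by simp
      also have "\<dots> = 0"
        using integral_ibp_interior[OF ab g, of m x] x by (simp add: G_def)
      finally show "(\<integral>y. ?f (x(m := y)) \<partial>beta_measure a b) = 0" .
    qed
  qed
  finally have "(\<integral>x. ?f x \<partial>B) = 0" .
  moreover have "(\<integral>x. ?f x \<partial>B) = a * (\<integral>x. ?q x * V x \<partial>B) - (a + b) * (\<integral>x. ?q x * x m * V x \<partial>B)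
     + 2 * g * (\<Sum>j<m. \<integral>x. ?T j x \<partial>B)"
    unfolding Bochner_Integration.integral_add[OF int12 int3] Bochner_Integration.integral_diff[OF int1 int2]
      integral_mult_right_zero
    using intT by (subst Bochner_Integration.integral_sum) auto
  ultimately show ?thesis by simp
qed

text \<open>Let J and K be the moments without and with the extra factor \<open>x m\<close>. In the
  sum of \<open>moment_ibp\<close> each index below k contributes - K / 2 and each of the other m -
  k contributes J / 2 - K. Solving for K gives the recurrence; the natural subtractions are exact
  because \<open>k \<le> m\<close>.\<close>

lemma aomoto:
  assumes k: "k \<le> m"
  shows "(a + b + g * real (2 * m - k)) * (\<integral>x. (\<Prod>i<Suc k. x i) * V x \<partial>B)
       = (a + g * real (m - k)) * (\<integral>x. (\<Prod>i<k. x i) * V x \<partial>B)"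
proof -
  let ?J = "\<integral>x. (\<Prod>i<k. x i) * V x \<partial>B" and ?K = "\<integral>x. (\<Prod>i<k. x i) * x m * V x \<partial>B"
  let ?T = "\<lambda>j. \<integral>x. (\<Prod>i<k. x i) * (x m * (1 - x m)) * (V x / (x m - x j)) \<partial>B"
  have "2 * (\<Sum>j<m. ?T j) = (\<Sum>j\<in>{..<k} \<union> {k..<m}. 2 * ?T j)"
    using k by (simp add: sum_distrib_left ivl_disj_un)
  also have "\<dots> = (\<Sum>j<k. 2 * ?T j) + (\<Sum>j\<in>{k..<m}. 2 * ?T j)"
    by (intro sum.union_disjoint) auto
  also have "(\<Sum>j<k. 2 * ?T j) = (\<Sum>j<k. - ?K)"
    using k by (intro sum.cong refl moment_quotient_less) auto
  also have "(\<Sum>j\<in>{k..<m}. 2 * ?T j) = (\<Sum>j\<in>{k..<m}. ?J - 2 * ?K)"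
    by (intro sum.cong refl moment_quotient_ge) auto
  finally have "2 * (\<Sum>j<m. ?T j) = - real k * ?K + real (m - k) * (?J - 2 * ?K)"
    by simp
  then have "a * ?J - (a + b) * ?K + g * (- real k * ?K + real (m - k) * (?J - 2 * ?K)) = 0"
    using moment_ibp[OF k] by (simp only: mult_ac)
  then have "(a + b + g * real (2 * m - k)) * ?K = (a + g * real (m - k)) * ?J"
    using k by (simp add: of_nat_diff algebra_simps)
  moreover have "(\<integral>x. (\<Prod>i<Suc k. x i) * V x \<partial>B) = ?K"
    using moment_last[of k k] k by simp
  ultimately show ?thesis by simp
qed

end

text \<open>Raising \<open>a\<close> by 1 inserts all \<open>N\<close> factors \<open>x i\<close>.
  This moment is reached from the one without factors by \<open>N\<close> steps of
  \<open>aomoto\<close>.\<close>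

lemma selberg_shift:
  assumes ab: "a > 0" "b > 0" and g: "g \<ge> 1"
  shows "selberg N (a + 1) b g
       = selberg N a b g * (\<Prod>j<N. (a + g * real j) / (a + b + g * real (N - 1 + j)))"
proof (cases N)
  case 0
  have "selberg 0 c b g = 1" if "c > 0" for c
    by (simp add: selberg_def PiM_empty)
  then show ?thesis using 0 ab by simp
next
  case (Suc m)
  define J where "J k = (\<integral>x. (\<Prod>i<k. x i) * vandermonde (Suc m) g x \<partial>beta_PiM (Suc m) a b)" for k :: nat
  have step: "J (Suc k) = J k * ((a + g * real (m - k)) / (a + b + g * real (2 * m - k)))" if "k \<le> m" for k
  proof -
    have "a + b + g * real (2 * m - k) > 0" using ab g by (intro add_pos_nonneg) auto
    then show ?thesis using aomoto[OF ab g that] by (simp add: J_def field_simps)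
  qed
  have "J k = J 0 * (\<Prod>i<k. (a + g * real (m - i)) / (a + b + g * real (2 * m - i)))" if "k \<le> Suc m" for k
    using that by (induction k) (simp_all add: step)
  from this[of "Suc m"] have "J (Suc m) = J 0 * (\<Prod>i<Suc m. (a + g * real (m - i)) / (a + b + g * real (2 * m - i)))"
    by simp
  \<comment> \<open>The product is read backwards with j = m - i, where 2 m - i = m + (m -
    i).\<close>
  also have "(\<Prod>i<Suc m. (a + g * real (m - i)) / (a + b + g * real (2 * m - i)))
      = (\<Prod>j<Suc m. (a + g * real j) / (a + b + g * real (m + j)))"
  proof -
    have "2 * m - i = m + (m - i)" if "i < Suc m" for i using that by simp
    then show ?thesis
      unfolding prod.nat_diff_reindex[of "\<lambda>j. (a + g * real j) / (a + b + g * real (m + j))" "Suc m", symmetric]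
      by (intro prod.cong) simp_all
  qed
  finally have "J (Suc m) = J 0 * (\<Prod>j<N. (a + g * real j) / (a + b + g * real (N - 1 + j)))"
    by (simp add: Suc)
  moreover have "J 0 = selberg N a b g"
    by (simp add: J_def selberg_def Suc)
  moreover have "selberg N (a + 1) b g = J (Suc m)"
  proof -
    have "selberg N (a + 1) b g = (\<integral>x. (\<Prod>i<Suc m. x i powr 1) * vandermonde (Suc m) g x \<partial>beta_PiM (Suc m) a b)"
      unfolding selberg_def Suc using ab by (intro integral_beta_PiM_shift) auto
    also have "\<dots> = J (Suc m)"
      unfolding J_def
    proof (rule integral_cong_AE)
      show "AE x in beta_PiM (Suc m) a b. (\<Prod>i<Suc m. x i powr 1) * vandermonde (Suc m) g x
          = (\<Prod>i<Suc m. x i) * vandermonde (Suc m) g x"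
        using AE_beta_PiM[OF ab, of "Suc m"] 
      proof eventually_elim
        fix x :: "nat \<Rightarrow> real" assume "\<forall>i<Suc m. 0 < x i \<and> x i < 1"
        then have "(\<Prod>i<Suc m. x i powr 1) = (\<Prod>i<Suc m. x i)"
          by (intro prod.cong) auto
        then show "(\<Prod>i<Suc m. x i powr 1) * vandermonde (Suc m) g x = (\<Prod>i<Suc m. x i) * vandermonde (Suc m) g x"
          by simp
      qed
    qed measurable
    finally show ?thesis .
  qed
  ultimately show ?thesis by simp
qed

text \<open>The boundary value at 0 is the product of the x_i^(2 g), which raises the parameter 1 of
  the other \<open>m\<close> variables to 2 g + 1. The remaining terms are symmetrised: ((1 - x_m) -
  (1 - x_j)) / (x_m - x_j) = -1, so each of them contributes minus half of the Selberg
  integral.\<close>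

lemma selberg_pin:
  assumes b: "b > 0" and g: "g \<ge> 1"
  shows "(b + g * real m) * selberg (Suc m) 1 b g = selberg m (2 * g + 1) b g"
proof -
  let ?B = "beta_PiM (Suc m) 1 b" and ?V = "vandermonde (Suc m) g"
  let ?T = "\<lambda>j x. (1 - x m) * (?V x / (x m - x j))"
  let ?s = "\<lambda>j x. \<lambda>k\<in>{..<Suc m}. x (Transposition.transpose m j k)"
  let ?f = "\<lambda>x. - b * ?V x + 2 * g * (\<Sum>j<m. ?T j x)"
  have intV: "integrable ?B ?V"
    using integrable_moment[OF real_one_pos b g, of 0 m] by simp
  have measT: "?T j \<in> borel_measurable (PiM {..<Suc m} (\<lambda>_. borel))" if "j < m" for j
    using that by (intro moment_measurable; simp)
  have intT: "integrable ?B (?T j)" if "j < m" for j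
  proof (rule integrable_mult_vandermonde_quotient[OF real_one_pos b g _ that, where c = 1])
    show "(\<lambda>x. 1 - x m :: real) \<in> borel_measurable (PiM {..<Suc m} (\<lambda>_. borel))"
      by (intro borel_measurable_diff borel_measurable_const measurable_component_real) simp
    fix x :: "nat \<Rightarrow> real" assume "\<And>i. i < Suc m \<Longrightarrow> 0 < x i \<and> x i < 1"
    from this[of m] show "\<bar>1 - x m\<bar> \<le> 1" by simp
  qed
  have T: "2 * (\<integral>x. ?T j x \<partial>?B) = - selberg (Suc m) 1 b g" if j: "j < m" for j
  proof -
    have swap: "?T j (?s j x) = - ?V x - ?T j x" for x
    proof (cases "x m = x j")
      case True
      then have "?V x = 0" using j by (intro vandermonde_eq_0[of m _ j]) auto
      then show ?thesis using j by (simp add: vandermonde_swap_last del: restrict_apply)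
    next
      case False
      have s: "?s j x m = x j" "?s j x j = x m" using j by auto
      show ?thesis
        unfolding s vandermonde_swap_last[OF less_SucI[OF j]]
        using False by (simp add: divide_simps) (simp add: algebra_simps)
    qed
    have "(\<integral>x. ?T j x \<partial>?B) = (\<integral>x. ?T j (?s j x) \<partial>?B)"
      using integral_swap_last[OF real_one_pos b measT[OF j], of j] j by simp
    also have "\<dots> = (\<integral>x. - ?V x - ?T j x \<partial>?B)"
      by (simp only: swap)
    also have "\<dots> = - selberg (Suc m) 1 b g - (\<integral>x. ?T j x \<partial>?B)"
      using intV intT[OF j] by (subst Bochner_Integration.integral_diff) (auto simp: selberg_def)
    finally show ?thesis by simp
  qed
  have int3: "integrable ?B (\<lambda>x. 2 * g * (\<Sum>j<m. ?T j x))"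
    using intT by (intro integrable_mult_right Bochner_Integration.integrable_sum) auto
  have int1: "integrable ?B (\<lambda>x. - b * ?V x)"
    using intV by (intro integrable_mult_right)
  have "(\<integral>x. ?f x \<partial>?B) = - b * selberg (Suc m) 1 b g + 2 * g * (\<Sum>j<m. \<integral>x. ?T j x \<partial>?B)"
    unfolding Bochner_Integration.integral_add[OF int1 int3] integral_mult_right_zero selberg_def
    using intT by (subst Bochner_Integration.integral_sum) auto
  also have "2 * g * (\<Sum>j<m. \<integral>x. ?T j x \<partial>?B) = g * (\<Sum>j<m. 2 * (\<integral>x. ?T j x \<partial>?B))"
    by (simp only: sum_distrib_left mult_ac)
  also have "(\<Sum>j<m. 2 * (\<integral>x. ?T j x \<partial>?B)) = (\<Sum>j<m. - selberg (Suc m) 1 b g)"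
    by (intro sum.cong refl T) simp
  finally have lhs: "(\<integral>x. ?f x \<partial>?B) = - (b + g * real m) * selberg (Suc m) 1 b g"
    by (simp add: algebra_simps)
  have AE: "AE x in beta_PiM m 1 b. (\<integral>y. ?f (x(m := y)) \<partial>beta_measure 1 b)
      = - ((\<Prod>i<m. x i powr (2 * g)) * vandermonde m g x)"
    using AE_beta_PiM[OF real_one_pos b, of m]
  proof eventually_elim
    fix x :: "nat \<Rightarrow> real" assume x: "\<forall>i<m. 0 < x i \<and> x i < 1"
    define G where "G y = (\<Prod>i<m. \<bar>y - x i\<bar> powr (2 * g))" for y
    have "?f (x(m := y)) = vandermonde m g x *
        (- b * G y + (1 - y) * (\<Sum>j<m. 2 * g * (G y / (y - x j))))" for y
    proof -
      define S where "S = (\<Sum>j<m. 2 * g * (G y / (y - x j)))"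
      have eq: "2 * g * (\<Sum>j<m. ?T j (x(m := y))) = vandermonde m g x * ((1 - y) * S)"
        unfolding vandermonde_fun_upd G_def[symmetric] S_def sum_distrib_left
        by (intro sum.cong) auto
      show ?thesis
        unfolding S_def[symmetric] eq unfolding vandermonde_fun_upd G_def[symmetric]
        by (simp add: algebra_simps)
    qed
    then have "(\<integral>y. ?f (x(m := y)) \<partial>beta_measure 1 b) = vandermonde m g x *
        (\<integral>y. - b * G y + (1 - y) * (\<Sum>j<m. 2 * g * (G y / (y - x j))) \<partial>beta_measure 1 b)"
      by simp
    also have "\<dots> = vandermonde m g x * - G 0"
      using integral_ibp_boundary[OF b g, of m x] x by (simp add: G_def)
    also have "G 0 = (\<Prod>i<m. x i powr (2 * g))"
      using x by (auto simp: G_def intro!: prod.cong)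
    finally show "(\<integral>y. ?f (x(m := y)) \<partial>beta_measure 1 b) = - ((\<Prod>i<m. x i powr (2 * g)) * vandermonde m g x)"
      by (simp only: mult_minus_right mult.commute)
  qed
  have "?f \<in> borel_measurable (PiM {..<Suc m} (\<lambda>_. borel))"
    using measT by (intro borel_measurable_add borel_measurable_times borel_measurable_const
        borel_measurable_sum measurable_vandermonde) auto
  then have meas_inner: "(\<lambda>x. \<integral>y. ?f (x(m := y)) \<partial>beta_measure 1 b) \<in> borel_measurable (beta_PiM m 1 b)"
    by (rule measurable_integral_fun_upd[OF real_one_pos b])
  have meas_outer: "(\<lambda>x. - ((\<Prod>i<m. x i powr (2 * g)) * vandermonde m g x)) \<in> borel_measurable (beta_PiM m 1 b)"
    by measurable
  have e1: "(\<integral>x. ?f x \<partial>?B) = (\<integral>x. (\<integral>y. ?f (x(m := y)) \<partial>beta_measure 1 b) \<partial>beta_PiM m 1 b)"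
    by (rule integral_beta_PiM_Suc[OF real_one_pos b g Bochner_Integration.integrable_add[OF int1 int3]])
  have e2: "(\<integral>x. (\<integral>y. ?f (x(m := y)) \<partial>beta_measure 1 b) \<partial>beta_PiM m 1 b)
      = (\<integral>x. - ((\<Prod>i<m. x i powr (2 * g)) * vandermonde m g x) \<partial>beta_PiM m 1 b)"
    using meas_inner meas_outer AE by (rule integral_cong_AE)
  have e3: "(\<integral>x. - ((\<Prod>i<m. x i powr (2 * g)) * vandermonde m g x) \<partial>beta_PiM m 1 b) = - selberg m (2 * g + 1) b g"
    unfolding selberg_def using integral_beta_PiM_shift[OF real_one_pos b, of "2 * g" "vandermonde m g" m] g
    by (simp add: add.commute)
  show ?thesis using trans[OF e1 trans[OF e2 e3]] unfolding lhs by (simp add: algebra_simps)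
qed

section \<open>Selberg's formula\<close>

lemma selberg_antimono:
  assumes a: "0 < a" "a \<le> a'" and b: "b > 0" and g: "g \<ge> 1"
  shows "selberg N a' b g \<le> selberg N a b g"
proof -
  have "selberg N a' b g = (\<integral>x. (\<Prod>i<N. x i powr (a' - a)) * vandermonde N g x \<partial>beta_PiM N a b)"
    using integral_beta_PiM_shift[OF a(1) b, of "a' - a" "vandermonde N g" N] a by (simp add: selberg_def)
  also have "\<dots> \<le> selberg N a b g"
    unfolding selberg_def
  proof (rule integral_mono_AE)
    have P: "\<bar>\<Prod>i<N. x i powr (a' - a)\<bar> \<le> 1" if "\<And>i. i < N \<Longrightarrow> 0 < x i \<and> x i < 1" for x :: "nat \<Rightarrow> real"
      using that a by (auto simp: abs_prod less_imp_le intro!: prod_le_1 powr_le1)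
    have V: "\<bar>vandermonde N g x\<bar> \<le> 1" if "\<And>i. i < N \<Longrightarrow> 0 < x i \<and> x i < 1" for x
      using vandermonde_le_1[of g N x] that g by auto
    show "integrable (beta_PiM N a b) (vandermonde N g)"
      using V by (intro integrable_beta_PiM[OF a(1) b]) auto
    show "integrable (beta_PiM N a b) (\<lambda>x. (\<Prod>i<N. x i powr (a' - a)) * vandermonde N g x)"
      using P V by (intro integrable_beta_PiM[OF a(1) b, where c = 1]) (auto simp: abs_mult intro!: mult_le_one)
    show "AE x in beta_PiM N a b. (\<Prod>i<N. x i powr (a' - a)) * vandermonde N g x \<le> vandermonde N g x"
      using AE_beta_PiM[OF a(1) b, of N]
    proof eventually_elim
      fix x :: "nat \<Rightarrow> real" assume "\<forall>i<N. 0 < x i \<and> x i < 1"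
      then have "(\<Prod>i<N. x i powr (a' - a)) \<le> 1" using P[of x] by auto
      then show "(\<Prod>i<N. x i powr (a' - a)) * vandermonde N g x \<le> vandermonde N g x"
        by (intro mult_left_le_one_le) (auto intro: prod_nonneg)
    qed
  qed
  finally show ?thesis .
qed

text \<open>This is Euler's limit for Gamma: \<open>Gamma_series s n\<close> is n! n^s over the
  rising factorial of \<open>s\<close> of length n + 1, and that factorial times Gamma s is Gamma (n
  + s + 1).\<close>

lemma Gamma_ratio_tendsto:
  fixes s :: real
  assumes s: "s > 0"
  shows "(\<lambda>n. Gamma (real n + s + 1) / (fact n * real n powr s)) \<longlonglongrightarrow> 1"
proof -
  have G: "Gamma s \<noteq> 0" using Gamma_real_pos[OF s] by simp
  have "(\<lambda>n. Gamma s / Gamma_series s n) \<longlonglongrightarrow> Gamma s / Gamma s"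
    by (intro tendsto_divide tendsto_const Gamma_series_LIMSEQ G)
  moreover have "eventually (\<lambda>n. Gamma s / Gamma_series s n = Gamma (real n + s + 1) / (fact n * real n powr s)) sequentially"
    using eventually_gt_at_top[of 0]
  proof eventually_elim
    case (elim n)
    have "s \<notin> \<int>\<^sub>\<le>\<^sub>0" using s by (auto simp: nonpos_Ints_def)
    then have "pochhammer s (Suc n) * Gamma s = Gamma (s + real (Suc n))"
      using G by (subst pochhammer_Gamma) auto
    then show ?case
      using elim by (simp add: Gamma_series_def powr_def algebra_simps)
  qed
  ultimately show ?thesis using G by (simp add: tendsto_cong)
qed

text \<open>These are the factors of Selberg's formula that contain \<open>a\<close>. They obey the
  same recurrence in \<open>a\<close> as \<open>selberg\<close>.\<close>

definition selberg_factor :: "nat \<Rightarrow> real \<Rightarrow> real \<Rightarrow> real \<Rightarrow> real" where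
  "selberg_factor N a b g = (\<Prod>j<N. Gamma (a + g * real j) / Gamma (a + b + g * real (N - 1 + j)))"

lemma selberg_factor_pos: "a > 0 \<Longrightarrow> b > 0 \<Longrightarrow> g \<ge> 1 \<Longrightarrow> selberg_factor N a b g > 0"
  unfolding selberg_factor_def by (intro prod_pos ballI divide_pos_pos Gamma_real_pos add_pos_nonneg) auto

lemma selberg_factor_shift:
  assumes ab: "a > 0" "b > 0" and g: "g \<ge> 1"
  shows "selberg_factor N (a + 1) b g = selberg_factor N a b g * (\<Prod>j<N. (a + g * real j) / (a + b + g * real (N - 1 + j)))"
  unfolding selberg_factor_def prod.distrib[symmetric]
proof (rule prod.cong[OF refl])
  fix j
  have "a + g * real j > 0" "a + b + g * real (N - 1 + j) > 0"
    using ab g by (auto intro!: add_pos_nonneg)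
  then have "Gamma (a + g * real j + 1) = (a + g * real j) * Gamma (a + g * real j)"
    "Gamma (a + b + g * real (N - 1 + j) + 1) = (a + b + g * real (N - 1 + j)) * Gamma (a + b + g * real (N - 1 + j))"
    by (auto intro!: Gamma_plus1 simp: nonpos_Ints_def)
  moreover have "a + 1 + g * real j = a + g * real j + 1"
    "a + 1 + b + g * real (N - 1 + j) = a + b + g * real (N - 1 + j) + 1" by simp_all
  ultimately show "Gamma (a + 1 + g * real j) / Gamma (a + 1 + b + g * real (N - 1 + j)) =
         Gamma (a + g * real j) / Gamma (a + b + g * real (N - 1 + j)) *
         ((a + g * real j) / (a + b + g * real (N - 1 + j)))"
    by (simp only: times_divide_times_eq mult_ac)
qed

text \<open>The quotient with index j decays like n to the power - (b + g (N - 1 + j) - g j). This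
  exponent does not depend on the shift, so the powers cancel in the ratio of two shifts.\<close>

lemma selberg_factor_ratio_tendsto:
  assumes s: "s > 0" "t > 0" and b: "b > 0" and g: "g \<ge> 1"
  shows "(\<lambda>n. selberg_factor N (real n + 1 + s) b g / selberg_factor N (real n + 1 + t) b g) \<longlonglongrightarrow> 1"
proof -
  define r where "r s n = Gamma (real n + s + 1) / (fact n * real n powr s)" for s n
  define q where "q s j n = r (s + g * real j) n / r (s + b + g * real (N - 1 + j)) n" for s j n
  have r: "r u \<longlonglongrightarrow> 1" if "u > 0" for u
    unfolding r_def using that by (rule Gamma_ratio_tendsto)
  have q: "q u j \<longlonglongrightarrow> 1 / 1" if "u > 0" for u j
    unfolding q_def using that b g by (intro tendsto_divide r add_pos_nonneg add_pos_pos) auto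
  have "(\<lambda>n. (\<Prod>j<N. q s j n) / (\<Prod>j<N. q t j n)) \<longlonglongrightarrow> (\<Prod>j<N. 1 / 1) / (\<Prod>j<N. 1 / 1)"
    using s by (intro tendsto_divide tendsto_prod q) auto
  moreover have "eventually (\<lambda>n. (\<Prod>j<N. q s j n) / (\<Prod>j<N. q t j n) =
      selberg_factor N (real n + 1 + s) b g / selberg_factor N (real n + 1 + t) b g) sequentially"
    using eventually_gt_at_top[of 0]
  proof eventually_elim
    case (elim n)
    have "(\<Prod>j<N. q u j n) = selberg_factor N (real n + 1 + u) b g * (\<Prod>j<N. real n powr (b + g * real (N - 1 + j) - g * real j))"
      if u: "u > 0" for u
      unfolding selberg_factor_def prod.distrib[symmetric]
    proof (rule prod.cong[OF refl])
      fix j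
      have "q u j n = Gamma (real n + (u + g * real j) + 1) / Gamma (real n + (u + b + g * real (N - 1 + j)) + 1)
          * (real n powr (u + b + g * real (N - 1 + j)) / real n powr (u + g * real j))"
        by (simp add: q_def r_def)
      also have "real n powr (u + b + g * real (N - 1 + j)) / real n powr (u + g * real j)
          = real n powr (b + g * real (N - 1 + j) - g * real j)"
        using elim by (simp add: powr_diff[symmetric] algebra_simps)
      finally show "q u j n = Gamma (real n + 1 + u + g * real j) / Gamma (real n + 1 + u + b + g * real (N - 1 + j))
          * real n powr (b + g * real (N - 1 + j) - g * real j)"
        by (simp only: add_ac)
    qed
    moreover have "(\<Prod>j<N. real n powr (b + g * real (N - 1 + j) - g * real j)) \<noteq> 0"
      using elim by simp
    ultimately show ?case using s by simp
  qed
  ultimately show ?thesis by (simp add: tendsto_cong)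
qed

text \<open>As in the Bohr--Mollerup theorem, the recurrence under \<open>a \<mapsto> a + 1\<close> together with
  monotonicity determines the dependence on \<open>a\<close>.\<close>

lemma selberg_eq_selberg_factor:
  assumes a: "a > 0" and b: "b > 0" and g: "g \<ge> 1"
  shows "selberg N a b g = selberg N 1 b g / selberg_factor N 1 b g * selberg_factor N a b g"
proof -
  define f where "f a = selberg N a b g / selberg_factor N a b g" for a
  define k where "k = nat \<lfloor>a\<rfloor>"
  have k: "real k \<le> a" "a < real k + 1" using a by (auto simp: k_def)
  have f_Suc: "f (c + 1) = f c" if "c > 0" for c
  proof -
    define R where "R = (\<Prod>j<N. (c + g * real j) / (c + b + g * real (N - 1 + j)))"
    have "R > 0"
      unfolding R_def using that b g by (intro prod_pos ballI divide_pos_pos add_pos_nonneg) auto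
    then show ?thesis
      using selberg_shift[OF that b g, of N] selberg_factor_shift[OF that b g, of N]
      unfolding f_def R_def[symmetric] by simp
  qed
  have f_add: "f (c + real n) = f c" if "c > 0" for c n
  proof (induction n)
    case (Suc n)
    then show ?case using f_Suc[of "c + real n"] that by (simp add: add_ac)
  qed simp
  have S: "selberg N (c + real n) b g = f c * selberg_factor N (c + real n) b g" if "c > 0" for c n
    using f_add[OF that, of n] selberg_factor_pos[of "c + real n" b g N] that b g by (simp add: f_def field_simps)
  let ?G = "\<lambda>c. selberg_factor N c b g"
  have pos: "?G (real n + 1 + c) > 0" if "c > 0" for n c
    using that b g by (intro selberg_factor_pos) auto
  \<comment> \<open>The number \<open>a + 1\<close> lies between \<open>k + 1\<close> and
    \<open>k + 2\<close>, and at positive integers \<open>f\<close> has the value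
    \<open>f 1\<close>. Monotonicity compares the integrals at these three shifts of n + 1, and the
    corresponding factors become equal in the limit. The extra 1 keeps the lower shift positive when
    k = 0.\<close>
  have upper: "f a \<le> f 1 * (?G (real n + 1 + real (k + 1)) / ?G (real n + 1 + (a + 1)))" for n
  proof -
    have "selberg N (real n + 1 + (a + 1)) b g \<le> selberg N (real n + 1 + real (k + 1)) b g"
      using k b g by (intro selberg_antimono) auto
    moreover have "selberg N (real n + 1 + (a + 1)) b g = f a * ?G (real n + 1 + (a + 1))"
      using S[OF a, of "n + 2"] by (simp add: add_ac)
    moreover have "selberg N (real n + 1 + real (k + 1)) b g = f 1 * ?G (real n + 1 + real (k + 1))"
      using S[of 1 "n + k + 1"] by (simp add: add_ac)
    ultimately show ?thesis using pos[of "a + 1" n] a by (simp add: field_simps)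
  qed
  have lower: "f 1 * (?G (real n + 1 + real (k + 2)) / ?G (real n + 1 + (a + 1))) \<le> f a" for n
  proof -
    have "selberg N (real n + 1 + real (k + 2)) b g \<le> selberg N (real n + 1 + (a + 1)) b g"
      using k a b g by (intro selberg_antimono) auto
    moreover have "selberg N (real n + 1 + (a + 1)) b g = f a * ?G (real n + 1 + (a + 1))"
      using S[OF a, of "n + 2"] by (simp add: add_ac)
    moreover have "selberg N (real n + 1 + real (k + 2)) b g = f 1 * ?G (real n + 1 + real (k + 2))"
      using S[of 1 "n + k + 2"] by (simp add: add_ac)
    ultimately show ?thesis using pos[of "a + 1" n] a by (simp add: field_simps)
  qed
  have lim: "(\<lambda>n. f 1 * (?G (real n + 1 + s) / ?G (real n + 1 + (a + 1)))) \<longlonglongrightarrow> f 1 * 1" if "s > 0" for s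
    using that a b g by (intro tendsto_mult tendsto_const selberg_factor_ratio_tendsto) auto
  have "f a \<le> f 1 * 1"
    by (rule LIMSEQ_le_const[OF lim[of "real (k + 1)"]]) (use upper in auto)
  moreover have "f 1 * 1 \<le> f a"
    by (rule LIMSEQ_le_const2[OF lim[of "real (k + 2)"]]) (use lower in auto)
  ultimately have "f a = f 1" by simp
  then show ?thesis using selberg_factor_pos[OF a b g, of N] by (simp add: f_def field_simps)
qed

text \<open>By \<open>selberg_eq_selberg_factor\<close> only the value at \<open>a = 1\<close> is
  missing, and \<open>selberg_pin\<close> takes it from one variable fewer with parameter 2 g + 1.
  This is why \<open>a\<close> is generalised in the induction.\<close>

theorem selberg_formula:
  assumes "a > 0" "b > 0" "g \<ge> 1"
  shows "selberg N a b g = (\<Prod>j<N. Gamma (a + g * real j) * Gamma (b + g * real j) * Gamma (1 + g * real (j + 1))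
      / (Gamma (a + b + g * real (N - 1 + j)) * Gamma (1 + g)))"
  using assms
proof (induction N arbitrary: a)
  case 0
  then show ?case by (simp add: selberg_def PiM_empty)
next
  case (Suc m)
  note b = \<open>b > 0\<close> and g = \<open>g \<ge> 1\<close>
  let ?D = "\<lambda>a N j. Gamma (a + b + g * real (N - 1 + j))"
  let ?P = "\<lambda>f. \<Prod>j<m. f j :: real"
  let ?Q = "\<lambda>f. \<Prod>j<Suc m. f j :: real"
  have pos: "Gamma (c + g * real j) > 0" if "c > 0" for c j
    using that g by (intro Gamma_real_pos add_pos_nonneg) auto
  have bm: "b + g * real m > 0" using b g by (intro add_pos_nonneg) auto
  have Gbm: "Gamma (b + g * real m + 1) = (b + g * real m) * Gamma (b + g * real m)"
    using bm by (intro Gamma_plus1) (auto simp: nonpos_Ints_def)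
  have "(b + g * real m) * selberg (Suc m) 1 b g
      = ?P (\<lambda>j. Gamma (2 * g + 1 + g * real j) * Gamma (b + g * real j) * Gamma (1 + g * real (j + 1))
          / (Gamma (2 * g + 1 + b + g * real (m - 1 + j)) * Gamma (1 + g)))"
    unfolding selberg_pin[OF b g] using b g by (intro Suc.IH) auto
  also have "\<dots> = ?P (\<lambda>j. Gamma (1 + g * real (j + 2))) * ?P (\<lambda>j. Gamma (b + g * real j)) * ?P (\<lambda>j. Gamma (1 + g * real (j + 1)))
      / (?P (\<lambda>j. Gamma (1 + b + g * real (m + (j + 1)))) * ?P (\<lambda>j. Gamma (1 + g)))"
    unfolding prod.distrib[symmetric] prod_dividef[symmetric]
  proof (intro prod.cong refl)
    \<comment> \<open>As j < m forces m to be positive, the truncated m - 1 is exact here. The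
      summand 2 g moves j to j + 2 in the numerator and m - 1 + j to m + j + 1 in the
      denominator.\<close>
    fix j assume "j \<in> {..<m}"
    then have "2 * g + 1 + g * real j = 1 + g * real (j + 2)"
      "2 * g + 1 + b + g * real (m - 1 + j) = 1 + b + g * real (m + (j + 1))"
      by (auto simp: algebra_simps of_nat_diff)
    then show "Gamma (2 * g + 1 + g * real j) * Gamma (b + g * real j) * Gamma (1 + g * real (j + 1))
          / (Gamma (2 * g + 1 + b + g * real (m - 1 + j)) * Gamma (1 + g))
        = Gamma (1 + g * real (j + 2)) * Gamma (b + g * real j) * Gamma (1 + g * real (j + 1))
          / (Gamma (1 + b + g * real (m + (j + 1))) * Gamma (1 + g))"
      by (simp only:)
  qed
  finally have pin: "(b + g * real m) * selberg (Suc m) 1 b g = \<dots>" .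
  define A where "A = ?P (\<lambda>j. Gamma (1 + g * real (j + 2)))"
  define E where "E = ?P (\<lambda>j. Gamma (1 + g * real (j + 1)))"
  define Bm where "Bm = ?P (\<lambda>j. Gamma (b + g * real j))"
  define D where "D = ?P (\<lambda>j. Gamma (1 + b + g * real (m + (j + 1))))"
  have Apos: "A > 0" "E > 0" "D > 0" "Bm > 0"
    unfolding A_def E_def D_def Bm_def using b by ((intro prod_pos ballI pos; simp)+)
  have G1: "Gamma (1 + g) > 0" using g by (intro Gamma_real_pos) auto
  \<comment> \<open>The factor at \<open>a = 1\<close> has the same \<open>E\<close> and
    \<open>D\<close> as the pinned value, and Gamma (b + g m + 1) besides. Dividing cancels
    \<open>E\<close> and \<open>D\<close>, and the functional equation absorbs the coefficient b + g
    m.\<close>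
  have sa1: "selberg_factor (Suc m) 1 b g = E / (Gamma (b + g * real m + 1) * D)"
  proof -
    have "?Q (\<lambda>j. Gamma (1 + g * real j)) = E"
      unfolding E_def by (subst prod.lessThan_Suc_shift) simp
    moreover have "?Q (\<lambda>j. Gamma (1 + b + g * real (m + j))) = Gamma (b + g * real m + 1) * D"
      unfolding D_def by (subst prod.lessThan_Suc_shift) (simp add: add_ac)
    ultimately show ?thesis unfolding selberg_factor_def by (simp only: prod_dividef diff_Suc_1)
  qed
  \<comment> \<open>The product of Gamma (1 + g (j + 1)) over j up to m is split once at its last
    and once at its first term.\<close>
  have EA: "E * Gamma (1 + g * real (m + 1)) = Gamma (1 + g) * A"
  proof -
    have "E * Gamma (1 + g * real (m + 1)) = ?Q (\<lambda>j. Gamma (1 + g * real (j + 1)))"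
      by (simp add: E_def)
    also have "\<dots> = Gamma (1 + g) * A"
      unfolding A_def by (subst prod.lessThan_Suc_shift) (simp add: add_ac)
    finally show ?thesis .
  qed
  have "selberg (Suc m) 1 b g / selberg_factor (Suc m) 1 b g
      = Bm * Gamma (b + g * real m) * (E * Gamma (1 + g * real (m + 1))) / Gamma (1 + g) ^ Suc m"
  proof -
    have "selberg (Suc m) 1 b g = A * Bm * E / (D * Gamma (1 + g) ^ m) / (b + g * real m)"
    proof -
      have "u = v / t" if "t * u = v" "t > 0" for t u v :: real using that by (auto simp: field_simps)
      moreover have "(b + g * real m) * selberg (Suc m) 1 b g = A * Bm * E / (D * Gamma (1 + g) ^ m)"
        unfolding pin A_def Bm_def E_def D_def by simp
      ultimately show ?thesis using bm by blast
    qed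
    then show ?thesis
      unfolding sa1 EA Gbm using Apos G1 bm pos[OF b, of m]
      by (simp add: divide_simps) (simp add: mult_ac)
  qed
  then have "selberg (Suc m) a b g = (Bm * Gamma (b + g * real m)) * (E * Gamma (1 + g * real (m + 1))) / Gamma (1 + g) ^ Suc m
      * selberg_factor (Suc m) a b g"
    using selberg_eq_selberg_factor[OF Suc.prems, of "Suc m"] by (simp only: mult.assoc)
  also have "Bm * Gamma (b + g * real m) = ?Q (\<lambda>j. Gamma (b + g * real j))"
    by (simp add: Bm_def)
  also have "E * Gamma (1 + g * real (m + 1)) = ?Q (\<lambda>j. Gamma (1 + g * real (j + 1)))"
    by (simp add: E_def)
  also have "Gamma (1 + g) ^ Suc m = ?Q (\<lambda>j. Gamma (1 + g))"
    by simp
  finally show ?case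
    unfolding selberg_factor_def prod.distrib[symmetric] prod_dividef[symmetric]
    by (simp only: times_divide_times_eq mult_ac)
qed

section \<open>The logarithmic derivative of the Selberg integral\<close>

text \<open>In exponential form, differentiation in \<open>g\<close> produces the Selberg integral
  times a sum of Digamma values.\<close>

lemma selberg_exp_ln_Gamma:
  assumes a: "a > 0" and g: "g \<ge> 1"
  shows "selberg N a a g = exp (\<Sum>j<N. 2 * ln_Gamma (a + g * real j) + ln_Gamma (1 + g * real (j + 1))
      - ln_Gamma (2 * a + g * real (N - 1 + j)) - ln_Gamma (1 + g))"
proof -
  have G: "Gamma (c + g * real k) = exp (ln_Gamma (c + g * real k))" if "c > 0" for c k
    using that g by (intro Gamma_real_pos_exp add_pos_nonneg) auto
  have G1: "Gamma (1 + g) = exp (ln_Gamma (1 + g))" using g by (intro Gamma_real_pos_exp) auto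
  have E: "exp u * exp u * exp v / (exp w * exp z) = exp (2 * u + v - w - z)" for u v w z :: real
    by (simp add: exp_add exp_diff exp_double power2_eq_square)
  have a2: "a + a > 0" using a by simp
  show ?thesis
    unfolding selberg_formula[OF a a g] exp_sum[OF finite_lessThan] mult_2[of a]
      G[OF a] G[OF real_one_pos] G[OF a2] G1 E ..
qed

text \<open>The closed expression is differentiable at h = 0 from both sides, but it is known to
  equal the integral only for h \<ge> 0; hence the limit from the right.\<close>

lemma selberg_has_derivative:
  fixes N :: nat
  assumes a: "a > 0"
  defines "L \<equiv> (\<Sum>j<N. 2 * real j * Digamma (a + real j) + real (j + 1) * Digamma (real j + 2)
      - real (N - 1 + j) * Digamma (2 * a + real (N - 1 + j)) - Digamma 2)"
  shows "((\<lambda>h. (selberg N a a (1 + h) - selberg N a a 1) / h) \<longlongrightarrow> selberg N a a 1 * L) (at_right 0)"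
proof -
  let ?l = "\<lambda>h. \<Sum>j<N. 2 * ln_Gamma (a + (1 + h) * real j) + ln_Gamma (1 + (1 + h) * real (j + 1))
      - ln_Gamma (2 * a + (1 + h) * real (N - 1 + j)) - ln_Gamma (1 + (1 + h))"
  let ?f = "\<lambda>h. exp (?l h)"
  define f where "f = ?f"
  have D: "((\<lambda>h. ln_Gamma (c + (1 + h) * k)) has_real_derivative Digamma (c + k) * k) (at 0)"
    if "c + k > 0" for c k :: real
  proof (rule DERIV_chain2[where f = ln_Gamma])
    show "(ln_Gamma has_real_derivative Digamma (c + k)) (at (c + (1 + 0) * k))"
      using has_field_derivative_ln_Gamma_real[OF that] by simp
    show "((\<lambda>h. c + (1 + h) * k) has_real_derivative k) (at 0)"
      by (auto intro!: derivative_eq_intros)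
  qed
  have D2: "((\<lambda>h. ln_Gamma (1 + (1 + h))) has_real_derivative Digamma 2) (at 0)"
    using D[of 1 1] by simp
  have T: "((\<lambda>h. 2 * ln_Gamma (a + (1 + h) * real j) + ln_Gamma (1 + (1 + h) * real (j + 1))
      - ln_Gamma (2 * a + (1 + h) * real (N - 1 + j)) - ln_Gamma (1 + (1 + h))) has_real_derivative
      2 * real j * Digamma (a + real j) + real (j + 1) * Digamma (real j + 2)
      - real (N - 1 + j) * Digamma (2 * a + real (N - 1 + j)) - Digamma 2) (at 0)" for j
  proof -
    have "a + real j > 0" "1 + real (j + 1) > 0" "2 * a + real (N - 1 + j) > 0"
      using a by (auto intro: add_pos_nonneg)
    note d = D[OF this(1)] D[OF this(2)] D[OF this(3)]
    have e: "1 + real (j + 1) = real j + 2" by simp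
    show ?thesis
      by (rule DERIV_cong[OF DERIV_diff[OF DERIV_diff[OF DERIV_add[OF DERIV_cmult[OF d(1)] d(2)] d(3)] D2]])
        (simp only: e mult_ac)
  qed
  have "(?l has_real_derivative L) (at 0)"
    unfolding L_def by (rule DERIV_sum, rule T)
  from DERIV_fun_exp[OF this] have "(?f has_real_derivative ?f 0 * L) (at 0)" .
  then have "((\<lambda>h. (f (0 + h) - f 0) / h) \<longlongrightarrow> f 0 * L) (at 0)"
    unfolding f_def by (simp only: DERIV_def)
  then have "((\<lambda>h. (f h - f 0) / h) \<longlongrightarrow> f 0 * L) (at 0)" by simp
  then have lim: "((\<lambda>h. (f h - f 0) / h) \<longlongrightarrow> f 0 * L) (at_right 0)"
    by (rule filterlim_mono[OF _ order_refl at_le[OF subset_UNIV]])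
  have eq: "selberg N a a (1 + h) = f h" if "h \<ge> 0" for h
    using selberg_exp_ln_Gamma[OF a, of "1 + h" N] that by (simp add: f_def)
  have eq0: "selberg N a a 1 = f 0" using eq[of 0] by simp
  have "eventually (\<lambda>h. (f h - f 0) / h = (selberg N a a (1 + h) - selberg N a a 1) / h) (at_right 0)"
    using eventually_at_right_less[of 0]
  proof eventually_elim
    fix h :: real assume "0 < h"
    then have "selberg N a a (1 + h) = f h" by (intro eq) simp
    then show "(f h - f 0) / h = (selberg N a a (1 + h) - selberg N a a 1) / h"
      by (simp only: eq0)
  qed
  from Lim_transform_eventually[OF lim this] show ?thesis
    unfolding eq0 .
qed

text \<open>From 1 + h ln v \<le> v^h \<le> 1 the difference quotient lies between v ln v and 0, and
  - v ln v is at most 1 - v. The bound is uniform in \<open>h\<close>, as dominated convergence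
  requires.\<close>

lemma mult_ln_bounds:
  fixes v h :: real
  assumes v: "0 \<le> v" "v \<le> 1" and h: "0 < h"
  shows "\<bar>(v powr (1 + h) - v) / h\<bar> \<le> 1" "\<bar>v * ln v\<bar> \<le> 1"
proof -
  have "- (v * ln v) \<le> 1 \<and> 0 \<le> - (v * ln v) \<and> \<bar>(v powr (1 + h) - v) / h\<bar> \<le> - (v * ln v)"
  proof (cases "v = 0")
    case False
    then have pos: "v > 0" using v by simp
    have "ln (1 / v) \<le> 1 / v - 1" using pos by (intro ln_le_minus_one) auto
    then have "v * (- ln v) \<le> v * (1 / v - 1)" using pos by (intro mult_left_mono) (auto simp: ln_div)
    then have 1: "- (v * ln v) \<le> 1" using pos by (simp add: algebra_simps)
    have ln0: "ln v \<le> 0" using pos v by simp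
    then have 2: "0 \<le> - (v * ln v)" using pos by (simp add: mult_nonneg_nonpos)
    have "1 + h * ln v \<le> v powr h" using pos exp_ge_add_one_self[of "h * ln v"] by (simp add: powr_def)
    moreover have "v powr h \<le> 1" using v pos h by (intro powr_le1) auto
    ultimately have "\<bar>v powr h - 1\<bar> \<le> h * (- ln v)" by linarith
    then have "\<bar>v powr h - 1\<bar> / h \<le> - ln v" using h by (simp add: divide_le_eq mult.commute)
    then have "v * (\<bar>v powr h - 1\<bar> / h) \<le> v * (- ln v)" using pos by (intro mult_left_mono) auto
    moreover have "\<bar>(v powr (1 + h) - v) / h\<bar> = v * (\<bar>v powr h - 1\<bar> / h)"
    proof -
      have "v powr (1 + h) - v = v * (v powr h - 1)" using pos by (simp add: powr_add algebra_simps)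
      then show ?thesis using pos h by (simp add: abs_mult)
    qed
    ultimately show ?thesis using 1 2 by simp
  qed simp
  then show "\<bar>(v powr (1 + h) - v) / h\<bar> \<le> 1" "\<bar>v * ln v\<bar> \<le> 1" by linarith+
qed

lemma powr_difference_quotient_tendsto:
  fixes v :: real
  assumes "0 \<le> v"
  shows "((\<lambda>h. (v powr (1 + h) - v) / h) \<longlongrightarrow> v * ln v) (at_right 0)"
proof (cases "v = 0")
  case False
  then have v: "v > 0" using assms by simp
  have "((\<lambda>h. v powr (1 + h)) has_real_derivative v powr (1 + 0) * ln v) (at 0)"
    using v by (auto intro!: derivative_eq_intros)
  then have "((\<lambda>h. (v powr (1 + (0 + h)) - v powr (1 + 0)) / h) \<longlongrightarrow> v powr (1 + 0) * ln v) (at 0)"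
    by (simp only: DERIV_def)
  then have "((\<lambda>h. (v powr (1 + h) - v) / h) \<longlongrightarrow> v * ln v) (at 0)"
    using v by simp
  then show ?thesis
    by (rule filterlim_mono[OF _ order_refl at_le[OF subset_UNIV]])
qed simp

lemma integrable_vandermonde_ln_vandermonde:
  assumes "a > 0" "b > 0"
  shows "integrable (beta_PiM N a b) (\<lambda>x. vandermonde N 1 x * ln (vandermonde N 1 x))"
proof (rule integrable_beta_PiM[OF assms])
  fix x :: "nat \<Rightarrow> real" assume "\<And>i. i < N \<Longrightarrow> 0 < x i \<and> x i < 1"
  then have "vandermonde N 1 x \<le> 1" by (intro vandermonde_le_1) auto
  then show "\<bar>vandermonde N 1 x * ln (vandermonde N 1 x)\<bar> \<le> 1" by (intro mult_ln_bounds(2)[of _ 1]) auto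
qed measurable

lemma integrable_vandermonde:
  assumes "a > 0" "b > 0" "g \<ge> 0"
  shows "integrable (beta_PiM N a b) (vandermonde N g)"
  using vandermonde_le_1[OF assms(3)] by (intro integrable_beta_PiM[OF assms(1,2), where c = 1]) auto

text \<open>The right derivative of the Selberg integral at g = 1 is computed twice along h = 1 / (n
  + 1): under the integral by dominated convergence, and from Selberg's formula.\<close>

lemma integral_vandermonde_ln_vandermonde:
  assumes a: "a > 0"
  shows "(\<integral>x. vandermonde N 1 x * ln (vandermonde N 1 x) \<partial>beta_PiM N a a) = selberg N a a 1 *
     (\<Sum>j<N. 2 * real j * Digamma (a + real j) + real (j + 1) * Digamma (real j + 2)
      - real (N - 1 + j) * Digamma (2 * a + real (N - 1 + j)) - Digamma 2)"
proof -
  define h where "h n = inverse (real (Suc n))" for n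
  have h: "h n > 0" for n by (simp add: h_def)
  have h_lim: "filterlim h (at_right 0) sequentially"
    unfolding h_def by real_asymp
  let ?V = "vandermonde N 1" and ?B = "beta_PiM N a a"
  have V1: "AE x in ?B. ?V x \<le> 1"
    using AE_beta_PiM[OF a a, of N] by eventually_elim (auto intro: vandermonde_le_1)
  interpret finite_measure ?B
    by (rule finite_measure_PiM_const[OF finite_lessThan finite_measure_beta_measure[OF a a]])
  have "(\<lambda>n. \<integral>x. (?V x powr (1 + h n) - ?V x) / h n \<partial>?B) \<longlonglongrightarrow> (\<integral>x. ?V x * ln (?V x) \<partial>?B)"
  proof (rule integral_dominated_convergence[where w = "\<lambda>_. 1"])
    show "AE x in ?B. (\<lambda>n. (?V x powr (1 + h n) - ?V x) / h n) \<longlonglongrightarrow> ?V x * ln (?V x)"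
      by (intro AE_I2 filterlim_compose[OF powr_difference_quotient_tendsto h_lim]) simp
    show "AE x in ?B. norm ((?V x powr (1 + h n) - ?V x) / h n) \<le> 1" for n
      using V1
    proof eventually_elim
      fix x assume "?V x \<le> 1"
      then show "norm ((?V x powr (1 + h n) - ?V x) / h n) \<le> 1"
        using mult_ln_bounds(1)[OF vandermonde_nonneg _ h] by (simp only: real_norm_def)
    qed
    have [measurable]: "?V \<in> borel_measurable ?B" by measurable
    show "(\<lambda>x. ?V x * ln (?V x)) \<in> borel_measurable ?B"
      and "(\<lambda>x. (?V x powr (1 + h n) - ?V x) / h n) \<in> borel_measurable ?B" for n
      by measurable
    show "integrable ?B (\<lambda>_. 1 :: real)" by simp
  qed
  moreover have "(\<integral>x. (?V x powr (1 + h n) - ?V x) / h n \<partial>?B) = (selberg N a a (1 + h n) - selberg N a a 1) / h n" for n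
  proof -
    have "(\<integral>x. (?V x powr (1 + h n) - ?V x) / h n \<partial>?B) = (\<integral>x. (vandermonde N (1 + h n) x - ?V x) / h n \<partial>?B)"
      by (simp only: vandermonde_powr[of N "1 + h n"])
    also have "\<dots> = (selberg N a a (1 + h n) - selberg N a a 1) / h n"
    proof -
      have "integrable ?B (vandermonde N (1 + h n))" "integrable ?B ?V"
        using h[of n] by (intro integrable_vandermonde a; simp)+
      then show ?thesis
        by (simp add: selberg_def Bochner_Integration.integral_diff)
    qed
    finally show ?thesis .
  qed
  ultimately have "(\<lambda>n. (selberg N a a (1 + h n) - selberg N a a 1) / h n) \<longlonglongrightarrow> (\<integral>x. ?V x * ln (?V x) \<partial>?B)"
    by (simp only:)
  then show ?thesis
    using filterlim_compose[OF selberg_has_derivative[OF a, of N] h_lim] by (rule LIMSEQ_unique)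
qed

section \<open>Sums of Digamma values\<close>

text \<open>A discrete antiderivative. By Digamma (x + 1) = Digamma x + 1 / x, the forward
  difference of x (x - 1) Digamma x - x (x + 1) / 2 is 2 x Digamma x, and that of (x - 1) Digamma x
  - x is Digamma x.\<close>

definition Digamma_antidiff :: "real \<Rightarrow> real \<Rightarrow> real" where
  "Digamma_antidiff k x = x * (x - 1) * Digamma x - x * (x + 1) / 2 - 2 * k * ((x - 1) * Digamma x - x)"

lemma sum_Digamma:
  assumes "x > 0"
  shows "(\<Sum>j<N. 2 * (x + real j - k) * Digamma (x + real j))
       = Digamma_antidiff k (x + real N) - Digamma_antidiff k x"
proof (induction N)
  case (Suc N)
  define y where "y = x + real N"
  have y: "y > 0" using assms by (simp add: y_def)
  have D: "Digamma (y + 1) = Digamma y + 1 / y"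
    using y by (intro Digamma_plus1) auto
  have "Digamma_antidiff k (y + 1) = Digamma_antidiff k y + 2 * (y - k) * Digamma y"
    unfolding Digamma_antidiff_def D using y by (simp add: field_simps)
  moreover have "x + real (Suc N) = y + 1" by (simp add: y_def)
  ultimately show ?case using Suc by (simp only: sum.lessThan_Suc y_def)
qed simp

section \<open>Asymptotics of Digamma\<close>

lemma Digamma_minus_ln_tendsto:
  fixes x :: real
  assumes x: "x > 0"
  shows "(\<lambda>n. Digamma (x + real n) - ln (x + real n)) \<longlonglongrightarrow> 0"
proof -
  have sum: "Digamma (x + real n) = Digamma x + (\<Sum>k<n. inverse (x + real k))" for n
  proof (induction n)
    case (Suc n)
    have "Digamma (x + real n + 1) = Digamma (x + real n) + 1 / (x + real n)"
      using x by (intro Digamma_plus1) auto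
    then show ?case using Suc by (simp add: add_ac inverse_eq_divide)
  qed simp
  have "(\<lambda>n. Digamma x - (ln (real n) - (\<Sum>k<n. inverse (x + real k)))) \<longlonglongrightarrow> Digamma x - Digamma x"
    using Digamma_LIMSEQ[of x] x by (intro tendsto_diff tendsto_const) auto
  moreover have "(\<lambda>n. ln (real n) - ln (x + real n)) \<longlonglongrightarrow> 0"
    by real_asymp
  ultimately have "(\<lambda>n. (Digamma x - (ln (real n) - (\<Sum>k<n. inverse (x + real k)))) + (ln (real n) - ln (x + real n))) \<longlonglongrightarrow> (Digamma x - Digamma x) + 0"
    by (intro tendsto_add)
  then show ?thesis by (simp add: sum algebra_simps)
qed

text \<open>The error \<open>d\<close> tends to 0 along x + n, so its decrements control it. A
  decrement is the error of the trapezoidal rule for 1 / t on [y, y + 1]; comparing with the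
  midpoint rule bounds it by a difference of reciprocal squares, which telescopes.\<close>

lemma Digamma_approx:
  fixes x :: real
  assumes x: "x > 0"
  shows "\<bar>Digamma x - ln x + 1 / (2 * x)\<bar> \<le> 1 / x\<^sup>2"
proof -
  define d where "d x = Digamma x - ln x + 1 / (2 * x)" for x :: real
  have step: "\<bar>d y - d (y + 1)\<bar> \<le> 1 / y\<^sup>2 - 1 / (y + 1)\<^sup>2" if y: "y > 0" for y
  proof -
    have D: "Digamma (y + 1) = Digamma y + 1 / y" using y by (intro Digamma_plus1) auto
    have eq: "d y - d (y + 1) = (ln (y + 1) - ln y) - (1 / y + 1 / (y + 1)) / 2"
    proof -
      define p q where "p = 1 / y" and "q = 1 / (y + 1)"
      have "1 / (2 * y) = p / 2" "1 / (2 * (y + 1)) = q / 2" by (simp_all add: p_def q_def)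
      then show ?thesis unfolding d_def D p_def[symmetric] q_def[symmetric] by (simp add: field_simps)
    qed
    have "ln (y + 1) - ln y \<le> (1 / y + 1 / (y + 1)) / 2"
      using ln_inverse_approx_le[of y 1] y by (simp add: inverse_eq_divide)
    moreover have "ln (y + 1) - ln y \<ge> 2 / (2 * y + 1)"
      using ln_inverse_approx_ge[of y "y + 1"] y by (simp add: algebra_simps)
    moreover have "(1 / y + 1 / (y + 1)) / 2 - 2 / (2 * y + 1) \<le> 1 / y\<^sup>2 - 1 / (y + 1)\<^sup>2"
    proof -
      have "(1 / y + 1 / (y + 1)) / 2 - 2 / (2 * y + 1) = 1 / (2 * y * (y + 1) * (2 * y + 1))"
        using y by (simp add: divide_simps) (simp add: algebra_simps)
      also have "\<dots> \<le> (2 * y + 1) / (y\<^sup>2 * (y + 1)\<^sup>2)"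
        using y by (simp add: divide_simps) (simp add: algebra_simps power2_eq_square)
      also have "\<dots> = 1 / y\<^sup>2 - 1 / (y + 1)\<^sup>2"
        using y by (simp add: divide_simps) (simp add: algebra_simps power2_eq_square)
      finally show ?thesis .
    qed
    ultimately show ?thesis unfolding eq by linarith
  qed
  have "\<bar>d x - d (x + real n)\<bar> \<le> 1 / x\<^sup>2 - 1 / (x + real n)\<^sup>2" for n
  proof (induction n)
    case (Suc n)
    then show ?case using step[of "x + real n"] x by (simp add: add_ac)
  qed simp
  then have bound: "\<bar>d x - d (x + real n)\<bar> \<le> 1 / x\<^sup>2" for n
    by (rule order_trans) simp
  have "(\<lambda>n. (Digamma (x + real n) - ln (x + real n)) + 1 / (2 * (x + real n))) \<longlonglongrightarrow> 0 + 0"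
    by (intro tendsto_add Digamma_minus_ln_tendsto x) real_asymp
  then have "(\<lambda>n. \<bar>d x - d (x + real n)\<bar>) \<longlonglongrightarrow> \<bar>d x - 0\<bar>"
    by (intro tendsto_intros) (simp add: d_def)
  then have "\<bar>d x\<bar> \<le> 1 / x\<^sup>2"
    by (intro LIMSEQ_le_const2) (use bound in auto)
  then show ?thesis by (simp add: d_def)
qed

text \<open>Expanding ln (c n + s) gives s / (c n), and the term - 1 / (2 x) gives the - 1/2. The
  order n^(-2) of the error matches the quadratic polynomials by which the Digamma values will be
  multiplied.\<close>

lemma Digamma_asymp:
  fixes s c :: real
  assumes c: "c > 0"
  shows "(\<lambda>n. Digamma (c * real n + s) - ln (c * real n) - (s - 1/2) / (c * real n)) \<in> O(\<lambda>n. 1 / real n ^ 2)"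
proof -
  let ?d = "\<lambda>x. Digamma x - ln x + 1 / (2 * x) :: real"
  have pos: "eventually (\<lambda>n. c * real n + s > 0) sequentially"
    using c by real_asymp
  have "(\<lambda>n. ?d (c * real n + s)) \<in> O(\<lambda>n. 1 / (c * real n + s)\<^sup>2)"
  proof (rule bigoI[where c = 1])
    have "norm (?d x) \<le> 1 * norm (1 / x\<^sup>2)" if "x > 0" for x
      using Digamma_approx[OF that] by simp
    then show "eventually (\<lambda>n. norm (?d (c * real n + s)) \<le> 1 * norm (1 / (c * real n + s)\<^sup>2)) sequentially"
      using pos by (elim eventually_mono)
  qed
  also have "(\<lambda>n. 1 / (c * real n + s)\<^sup>2) \<in> O(\<lambda>n. 1 / real n ^ 2)"
    using c by real_asymp
  finally have 1: "(\<lambda>n. ?d (c * real n + s)) \<in> O(\<lambda>n. 1 / real n ^ 2)" .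
  have 2: "(\<lambda>n. ln (c * real n + s) - ln (c * real n) - s / (c * real n)) \<in> O(\<lambda>n. 1 / real n ^ 2)"
    using c by real_asymp
  have 3: "(\<lambda>n. 1 / (2 * (c * real n)) - 1 / (2 * (c * real n + s))) \<in> O(\<lambda>n. 1 / real n ^ 2)"
    using c by real_asymp
  have "(\<lambda>n. ?d (c * real n + s) + (ln (c * real n + s) - ln (c * real n) - s / (c * real n))
      + (1 / (2 * (c * real n)) - 1 / (2 * (c * real n + s)))) \<in> O(\<lambda>n. 1 / real n ^ 2)"
    by (intro sum_in_bigo 1 2 3)
  then show ?thesis by (simp add: algebra_simps diff_divide_distrib)
qed

text \<open>The sum is the logarithmic derivative at g = 1 of the Selberg integral in n + 1
  variables with both parameters equal to \<open>a\<close>. The last term accounts for stretching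
  [0,1] to [-1,1], which doubles the distances of n (n + 1) ordered pairs.\<close>

definition jacobi_energy :: "real \<Rightarrow> nat \<Rightarrow> real" where
  "jacobi_energy a n =
     - (\<Sum>j\<le>n. 2 * real j * Digamma (a + real j) + real (j + 1) * Digamma (real j + 2)
          - real (n + j) * Digamma (2 * a + real (n + j)) - Digamma 2) - real n * real (n + 1) * ln 2"

lemma Digamma_2: "Digamma (2 :: real) = 1 - euler_mascheroni"
  using Digamma_of_nat[of 1, where 'a = real] by (simp add: harm_def)

lemma jacobi_energy_closed_form:
  fixes a :: real
  assumes "a > 0"
  defines "S \<equiv> Digamma_antidiff"
  shows "jacobi_energy a n = - (S a (a + real n + 1) - S a a + (S 1 (real n + 3) - S 1 2) / 2
      - (S (2 * a) (2 * a + 2 * real n + 1) - S (2 * a) (2 * a + real n)) / 2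
      - (real n + 1) * (1 - euler_mascheroni)) - real n * (real n + 1) * ln 2"
proof -
  \<comment> \<open>The three sums are instances of \<open>sum_Digamma\<close> with (x, k) equal to
    (a, a), (2, 1) and (2 a + n, 2 a).\<close>
  have 1: "(\<Sum>j<Suc n. 2 * real j * Digamma (a + real j)) = S a (a + real n + 1) - S a a"
    using sum_Digamma[OF assms(1), of a "Suc n"] by (simp add: S_def add_ac del: sum.lessThan_Suc)
  have 2: "(\<Sum>j<Suc n. real (j + 1) * Digamma (real j + 2)) = (S 1 (real n + 3) - S 1 2) / 2"
  proof -
    have "(\<Sum>j<Suc n. real (j + 1) * Digamma (real j + 2)) = (\<Sum>j<Suc n. 2 * (2 + real j - 1) * Digamma (2 + real j)) / 2"
      unfolding sum_divide_distrib by (intro sum.cong) (simp_all add: add_ac)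
    also have "\<dots> = (S 1 (2 + real (Suc n)) - S 1 2) / 2"
      unfolding S_def by (subst sum_Digamma) auto
    also have "2 + real (Suc n) = real n + 3" by simp
    finally show ?thesis .
  qed
  have 3: "(\<Sum>j<Suc n. real (n + j) * Digamma (2 * a + real (n + j)))
      = (S (2 * a) (2 * a + 2 * real n + 1) - S (2 * a) (2 * a + real n)) / 2"
  proof -
    have "(\<Sum>j<Suc n. real (n + j) * Digamma (2 * a + real (n + j)))
        = (\<Sum>j<Suc n. 2 * (2 * a + real n + real j - 2 * a) * Digamma (2 * a + real n + real j)) / 2"
      unfolding sum_divide_distrib by (intro sum.cong) (simp_all add: add_ac)
    also have "\<dots> = (S (2 * a) (2 * a + real n + real (Suc n)) - S (2 * a) (2 * a + real n)) / 2"
      unfolding S_def using assms(1) by (subst sum_Digamma) auto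
    also have "2 * a + real n + real (Suc n) = 2 * a + 2 * real n + 1" by simp
    finally show ?thesis .
  qed
  have "jacobi_energy a n = - ((\<Sum>j<Suc n. 2 * real j * Digamma (a + real j))
      + (\<Sum>j<Suc n. real (j + 1) * Digamma (real j + 2))
      - (\<Sum>j<Suc n. real (n + j) * Digamma (2 * a + real (n + j)))
      - (real n + 1) * (1 - euler_mascheroni)) - real n * (real n + 1) * ln 2"
    by (simp add: jacobi_energy_def sum.distrib sum_subtractf lessThan_Suc_atMost Digamma_2 algebra_simps
        del: sum.lessThan_Suc)
  then show ?thesis unfolding 1 2 3 .
qed

text \<open>With N = n + 1, four Digamma values have coefficients quadratic in N, but P1 + P2 + P3 +
  P4 = - N + a^2 - a. Here N^2 ln N cancels, and both - N ln N and the term (a^2 - a) ln N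
  arise.\<close>

lemma jacobi_energy_asymp:
  assumes a: "a > 0"
  shows "(\<lambda>n. jacobi_energy a n - ((real n + 1)\<^sup>2 * ln 2 - (real n + 1) * ln (real n + 1)
      + (1 - euler_mascheroni - 2 * ln 2) * real n + (a\<^sup>2 - a) * ln (real n + 1))) \<in> O(\<lambda>_. 1)"
proof -
  \<comment> \<open>The remainder of the expansion is kept as an exact quantity, so that
    \<open>exact\<close> below is an identity and estimates come only afterwards.\<close>
  define e where "e c s N = Digamma (c * N + s) - ln (c * N) - (s - 1/2) / (c * N)" for c s N :: real
  have e: "(\<lambda>n. e c s (real n + 1)) \<in> O(\<lambda>n. 1 / (real n + 1) ^ 2)" if "c > 0" for c s
  proof -
    have "(\<lambda>n. e c s (real (Suc n))) \<in> O(\<lambda>n. 1 / real (Suc n) ^ 2)"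
      using Digamma_asymp[OF that, of s] unfolding e_def
      by (rule landau_o.big.compose) (rule filterlim_Suc)
    then show ?thesis by (simp add: add_ac)
  qed
  define c0 where "c0 = - 1 / 4 - ln 2 * (1 - a + 2 * a\<^sup>2) + a + (a - a\<^sup>2) * Digamma a - euler_mascheroni"
  define c1 where "c1 = 3 / 4 + a / 4 - 4 * a\<^sup>2 + 3 * a ^ 3"
  \<comment> \<open>Each polynomial is the coefficient of one Digamma value in the closed form; for
    instance P1 N = - (N + a - 1) (N - a).\<close>
  define P1 where "P1 N = N - N\<^sup>2 - a + a\<^sup>2" for N
  define P2 where "P2 N = - N / 2 - N\<^sup>2 / 2" for N :: real
  define P3 where "P3 N = - 3 * N + 2 * N\<^sup>2 + a - 2 * a\<^sup>2 + 1" for N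
  define P4 where "P4 N = 3 / 2 * N - N\<^sup>2 / 2 - a + 2 * a\<^sup>2 - 1" for N
  have exact: "jacobi_energy a n - (N\<^sup>2 * ln 2 - N * ln N + (1 - euler_mascheroni - 2 * ln 2) * real n + (a\<^sup>2 - a) * ln N)
      = c0 + c1 / N + P1 N * e 1 a N + P2 N * e 1 2 N + P3 N * e 2 (2 * a - 1) N + P4 N * e 1 (2 * a - 1) N"
    if N: "N = real n + 1" for n N
  proof -
    have Npos: "N > 0" and n: "real n = N - 1" using N by simp_all
    have ln2: "ln (2 * N) = ln 2 + ln N" using Npos by (simp add: ln_mult)
    define r y e1 e2 e3 e4 where "r = 1 / N" and "y = ln N" and "e1 = e 1 a N" and "e2 = e 1 2 N"
      and "e3 = e 2 (2 * a - 1) N" and "e4 = e 1 (2 * a - 1) N"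
    note defs = r_def y_def e1_def e2_def e3_def e4_def
    \<comment> \<open>With \<open>r = 1 / N\<close> as an atom all terms are polynomials; these
      rules cancel N against r at the places where ordered products put them.\<close>
    have Nr: "N * (r * z) = z" "N * r = 1" "N * (w * (r * z)) = w * z" "N * (v * (w * (r * z))) = v * (w * z)"
      for v w z using Npos by (simp_all add: r_def)
    note norm = algebra_simps power2_eq_square power3_eq_cube Nr add_divide_distrib diff_divide_distrib
    have x: "a + real n + 1 = N + a" "real n + 3 = N + 2" "2 * a + 2 * real n + 1 = 2 * N + (2 * a - 1)"
      "2 * a + real n = N + (2 * a - 1)"
      using n by simp_all
    have D: "Digamma (N + a) = y + (a - 1/2) * r + e1" "Digamma (N + 2) = y + 3/2 * r + e2"
      "Digamma (2 * N + (2 * a - 1)) = ln 2 + y + (2 * a - 3/2) * r / 2 + e3"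
      "Digamma (N + (2 * a - 1)) = y + (2 * a - 3/2) * r + e4"
      by (simp_all add: defs e_def ln2)
    have S1: "Digamma_antidiff a (N + a) = 1/2 - N + 2 * N * a - N * e1 - N * y - 1/2 * N ^ 2 + N ^ 2 * e1 + N ^ 2 * y
        - 3/2 * a + a * e1 - 1/2 * a * r + a * y + 3/2 * a ^ 2 - a ^ 2 * e1 + 3/2 * a ^ 2 * r - a ^ 2 * y - a ^ 3 * r"
      unfolding Digamma_antidiff_def D by (simp add: norm)
    have S2: "Digamma_antidiff 1 (N + 2) / 2 = 5/4 + 1/2 * N + 1/2 * N * e2 + 1/2 * N * y - 1/4 * N ^ 2
        + 1/2 * N ^ 2 * e2 + 1/2 * N ^ 2 * y"
      unfolding Digamma_antidiff_def D by (simp add: norm)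
    have S3: "Digamma_antidiff (2 * a) (2 * N + (2 * a - 1)) / 2 = 9/4 + ln 2 - 3 * ln 2 * N + 2 * ln 2 * N ^ 2
        + ln 2 * a - 2 * ln 2 * a ^ 2 - N + 4 * N * a - 3 * N * e3 - 3 * N * y - N ^ 2 + 2 * N ^ 2 * e3 + 2 * N ^ 2 * y
        - 9/2 * a + a * e3 + 1/4 * a * r + a * y + 3 * a ^ 2 - 2 * a ^ 2 * e3 + 5/2 * a ^ 2 * r - 2 * a ^ 2 * y
        - 2 * a ^ 3 * r + e3 - 3/4 * r + y"
      unfolding Digamma_antidiff_def D by (simp add: norm)
    have S4: "Digamma_antidiff (2 * a) (N + (2 * a - 1)) / 2 = 9/4 - 1/2 * N + 2 * N * a - 3/2 * N * e4 - 3/2 * N * y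
        - 1/4 * N ^ 2 + 1/2 * N ^ 2 * e4 + 1/2 * N ^ 2 * y - 9/2 * a + a * e4 + 1/2 * a * r + a * y + 3 * a ^ 2
        - 2 * a ^ 2 * e4 + 5 * a ^ 2 * r - 2 * a ^ 2 * y - 4 * a ^ 3 * r + e4 - 3/2 * r + y"
      unfolding Digamma_antidiff_def D by (simp add: norm)
    have c1: "c1 / N = c1 * r" by (simp add: r_def)
    have S0: "Digamma_antidiff 1 2 = 1" "Digamma_antidiff a a = (a - a\<^sup>2) * Digamma a + (3 * a\<^sup>2 - a) / 2"
      by (simp_all add: Digamma_antidiff_def Digamma_2 norm)
    show ?thesis
      unfolding jacobi_energy_closed_form[OF a] diff_divide_distrib x S1 S2 S3 S4 S0 c1
      unfolding n defs[symmetric] c0_def c1_def P1_def P2_def P3_def P4_def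
      by (simp add: algebra_simps power2_eq_square power3_eq_cube)
  qed
  have P: "P1 \<in> O[at_top](\<lambda>N. N\<^sup>2)" "P2 \<in> O[at_top](\<lambda>N. N\<^sup>2)" "P3 \<in> O[at_top](\<lambda>N. N\<^sup>2)" "P4 \<in> O[at_top](\<lambda>N. N\<^sup>2)"
    unfolding P1_def P2_def P3_def P4_def by real_asymp+
  have Pe: "(\<lambda>n. P (real n + 1) * e c s (real n + 1)) \<in> O(\<lambda>_. 1)" if "P \<in> O[at_top](\<lambda>N. N\<^sup>2)" "c > 0" for P c s
  proof -
    have "(\<lambda>n. P (real n + 1)) \<in> O(\<lambda>n. (real n + 1)\<^sup>2)"
      using that(1) by (rule landau_o.big.compose) real_asymp
    then have "(\<lambda>n. P (real n + 1) * e c s (real n + 1)) \<in> O(\<lambda>n. (real n + 1)\<^sup>2 * (1 / (real n + 1)\<^sup>2))"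
      by (intro landau_o.big.mult e that)
    also have "(\<lambda>n. (real n + 1)\<^sup>2 * (1 / (real n + 1)\<^sup>2)) = (\<lambda>_. 1)"
      by (intro ext) (simp add: add_pos_nonneg less_imp_neq[symmetric])
    finally show ?thesis .
  qed
  have "(\<lambda>_::nat. c0) \<in> O(\<lambda>_. 1)" "(\<lambda>n. c1 / (real n + 1)) \<in> O(\<lambda>_. 1)"
    by real_asymp+
  then show ?thesis
    unfolding exact[OF refl] by (intro sum_in_bigo Pe P) auto
qed

text \<open>The odd reciprocals up to 2 n are all reciprocals minus the even ones, and the even ones
  add up to half of \<open>harm n\<close>.\<close>

lemma harm_odd_sum: "(\<Sum>k<n. 2 / real (2 * k + 1)) = 2 * harm (2 * n) - harm n"
proof (induction n)
  case (Suc n)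
  define p q where "p = 1 / (2 * real n + 1)" and "q = 1 / (real n + 1)"
  have "harm (2 * Suc n) = harm (2 * n) + p + 1 / (2 * real n + 2)"
    by (simp add: harm_Suc inverse_eq_divide add_ac p_def)
  also have "1 / (2 * real n + 2) = q / 2" by (simp add: q_def field_simps)
  finally have "harm (2 * Suc n) = harm (2 * n) + p + q / 2" .
  moreover have "harm (Suc n) = harm n + q"
    by (simp add: harm_Suc inverse_eq_divide add_ac q_def)
  moreover have "2 / real (2 * n + 1) = 2 * p" by (simp add: p_def add_ac)
  ultimately show ?case using Suc by (simp only: sum.lessThan_Suc) simp
qed (simp add: harm_def)

text \<open>At a = 1/2 the Digamma arguments that depend on n are n + 3/2, n + 3, 2 n + 2 and n + 1.
  All values are thus harmonic numbers up to constants, with 2 ln 2 coming from the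
  half-integers.\<close>

lemma jacobi_energy_half:
  assumes "n \<ge> 1"
  shows "jacobi_energy (1/2) n = (real n + 1)\<^sup>2 * ln 2
             - ((real n + 1) * ln 2 + 3/4 * harm n + real n * harm (2 * n - 1)
                + harm (2 * n) / 2 - real n + 1/2)"
proof -
  define h where "h = (harm n :: real)"
  define k where "k = (harm (2 * n) :: real)"
  define N where "N = real n"
  have N: "N > 0" using assms by (simp add: N_def)
  have h1: "harm (2 * n - 1) = k - 1 / (2 * N)"
  proof -
    have "Suc (2 * n - 1) = 2 * n" using assms by simp
    then have "k = harm (2 * n - 1) + inverse (real (2 * n))"
      using harm_Suc[of "2 * n - 1", where 'a = real] by (simp only: k_def)
    then show ?thesis by (simp add: inverse_eq_divide N_def)
  qed
  have D1: "Digamma (1/2 + real n + 1) = 2 * (k + 1 / (2 * N + 1) + 1 / (2 * N + 2)) - (h + 1 / (N + 1))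
      - euler_mascheroni - 2 * ln 2"
  proof -
    have "Digamma (real (Suc n) + 1/2) = (\<Sum>k<Suc n. 2 / real (2 * k + 1)) - euler_mascheroni - 2 * ln 2"
      using Digamma_half_integer[of "Suc n", where 'a = real] by simp
    also have "\<dots> = 2 * harm (2 * Suc n) - harm (Suc n) - euler_mascheroni - 2 * ln 2"
      by (simp only: harm_odd_sum)
    finally show ?thesis
      by (simp add: harm_Suc inverse_eq_divide h_def k_def N_def add_ac)
  qed
  have D2: "Digamma (real n + 3) = h + 1 / (N + 1) + 1 / (N + 2) - euler_mascheroni"
    using Digamma_of_nat[of "Suc (Suc n)", where 'a = real]
    by (simp add: harm_Suc inverse_eq_divide h_def N_def add_ac)
  have D3: "Digamma (2 * (1/2) + 2 * real n + 1) = k + 1 / (2 * N + 1) - euler_mascheroni"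
    using Digamma_of_nat[of "Suc (2 * n)", where 'a = real]
    by (simp add: harm_Suc inverse_eq_divide k_def N_def add_ac)
  have D4: "Digamma (2 * (1/2) + real n) = h - euler_mascheroni"
    using Digamma_of_nat[of n, where 'a = real] by (simp add: h_def add_ac)
  have Dh: "Digamma (1/2 :: real) = - euler_mascheroni - 2 * ln 2"
    using Digamma_one_half[where 'a = real] by simp
  have half: "(1/2 :: real) > 0" by simp
  \<comment> \<open>The reciprocals become atoms; the rules that follow lower the degree of every
    product of one of them with N.\<close>
  define p q r where "p = 1 / (N + 1)" and "q = 1 / (2 * N + 1)" and "r = 1 / (N + 2)"
  have p: "p * (N + 1) = 1" and q: "q * (2 * N + 1) = 1" and r: "r * (N + 2) = 1"
    using N by (simp_all add: p_def q_def r_def)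
  have p': "N * p = 1 - p" and q': "N * q = (1 - q) / 2" and r': "N * r = 1 - 2 * r"
    using p q r by (simp_all add: algebra_simps)
  have p'': "N * (N * p) = N - (1 - p)" and r'': "N * (N * r) = N - 2 * (1 - 2 * r)"
    unfolding p' r' right_diff_distrib mult_1_right using p' r' by simp_all
  have pc: "N * (p * c) = c - p * c" for c using p' by (metis left_diff_distrib mult.assoc mult_1)
  have qc: "N * (q * c) = c / 2 - q * c / 2" for c
  proof -
    have "N * (q * c) = (1 - q) / 2 * c" using q' by (metis mult.assoc)
    then show ?thesis by (simp add: algebra_simps)
  qed
  have p2: "1 / (2 * N + 2) = p / 2" using N by (simp add: p_def field_simps)
  have N1: "N * (k - 1 / (2 * N)) = N * k - 1/2" using N by (simp add: field_simps)
  show ?thesis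
    unfolding jacobi_energy_closed_form[OF half] Digamma_antidiff_def D1 D2 D3 D4 Dh Digamma_2 h1
    unfolding N_def[symmetric] h_def[symmetric] k_def[symmetric] p2 N1
    unfolding p_def[symmetric] q_def[symmetric] r_def[symmetric]
    by (simp add: algebra_simps power2_eq_square p' q' r' p'' r'' pc qc add_divide_distrib diff_divide_distrib)
qed

section \<open>Determinantal points\<close>

text \<open>Subtracting \<open>coeff Q m\<close> times the monic product removes the coefficient of
  degree \<open>m\<close>; a nonzero remainder would have \<open>m\<close> roots but degree below
  \<open>m\<close>. Since \<open>coeff Q m\<close> may be 0, smaller degrees are covered.\<close>

lemma poly_eq_prod_roots:
  fixes Q :: "real poly"
  assumes deg: "degree Q \<le> m" and inj: "inj_on x {..<m}" and root: "\<And>i. i < m \<Longrightarrow> poly Q (x i) = 0"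
  shows "poly Q y = coeff Q m * (\<Prod>i<m. y - x i)"
proof -
  define P where "P = (\<Prod>i<m. [:- x i, 1:])"
  have degP: "degree P = m" unfolding P_def by (subst degree_prod_eq_sum_degree) auto
  have "lead_coeff P = 1" unfolding P_def by (simp add: lead_coeff_prod)
  then have coP: "coeff P m = 1" using degP by simp
  define D where "D = Q - Polynomial.smult (coeff Q m) P"
  have "D = 0"
  proof (rule ccontr)
    assume D: "D \<noteq> 0"
    have "degree D \<le> m"
      unfolding D_def using deg degP by (intro degree_diff_le) (auto intro: order_trans[OF degree_smult_le])
    moreover have "coeff D m = 0" by (simp add: D_def coP)
    ultimately have "degree D < m"
      using D by (metis le_neq_implies_less leading_coeff_0_iff)
    have "x ` {..<m} \<subseteq> {z. poly D z = 0}"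
      using root by (auto simp: D_def P_def poly_prod intro!: prod_zero)
    then have "card (x ` {..<m}) \<le> card {z. poly D z = 0}"
      using poly_roots_finite[OF D] by (intro card_mono)
    also have "\<dots> \<le> degree D" by (rule card_poly_roots_bound[OF D])
    finally show False using \<open>degree D < m\<close> inj by (simp add: card_image)
  qed
  then have "Q = Polynomial.smult (coeff Q m) P" by (simp add: D_def)
  then have "poly Q y = coeff Q m * poly P y" by (metis poly_smult)
  then show ?thesis by (simp add: P_def poly_prod)
qed

text \<open>As a function of the last point the determinant is a polynomial of degree at most
  \<open>m\<close> that vanishes at the other points. Its coefficient of degree \<open>m\<close> is
  the smaller determinant times \<open>lead_coeff (C m)\<close>. If earlier points coincide, both
  sides are 0.\<close>

lemma det_poly_vandermonde:
  fixes C :: "nat \<Rightarrow> real poly"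
  assumes deg: "\<And>k. degree (C k) = k"
  shows "Determinant.det (Matrix.mat N N (\<lambda>(i, j). poly (C j) (x i)))
       = (\<Prod>k<N. lead_coeff (C k)) * (\<Prod>j<N. \<Prod>i<j. x j - x i)"
proof (induction N arbitrary: x)
  case 0
  then show ?case by simp
next
  case (Suc m)
  let ?A = "\<lambda>x. Matrix.mat (Suc m) (Suc m) (\<lambda>(i, j). poly (C j) (x i))"
  have car: "?A x \<in> carrier_mat (Suc m) (Suc m)" for x by simp
  define Q where "Q = (\<Sum>j<Suc m. Polynomial.smult (cofactor (?A x) m j) (C j))"
  \<comment> \<open>Moving the last point changes only the deleted row, so the cofactors are
    constant coefficients.\<close>
  have del: "mat_delete (?A (x(m := y))) m j = mat_delete (?A x) m j" for y j
    by (intro eq_matI) (auto simp: mat_delete_def)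
  have det: "Determinant.det (?A (x(m := y))) = poly Q y" for y
  proof -
    have "Determinant.det (?A (x(m := y))) = (\<Sum>j<Suc m. ?A (x(m := y)) $$ (m, j) * cofactor (?A (x(m := y))) m j)"
      by (rule laplace_expansion_row[OF car]) simp
    also have "\<dots> = (\<Sum>j<Suc m. poly (C j) y * cofactor (?A x) m j)"
      by (intro sum.cong) (simp_all only: cofactor_def del, simp_all)
    finally show ?thesis by (simp add: Q_def poly_sum mult.commute)
  qed
  have det_eq_0: "Determinant.det (?A z) = 0" if "i < Suc m" "j < Suc m" "i \<noteq> j" "z i = z j" for z i j
    by (rule det_identical_rows[OF car that(3,1,2)]) (use that in \<open>auto intro!: eq_vecI\<close>)
  have "mat_delete (?A x) m m = Matrix.mat m m (\<lambda>(i, j). poly (C j) (x i))"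
    by (intro eq_matI) (auto simp: mat_delete_def)
  then have cof: "cofactor (?A x) m m = (\<Prod>k<m. lead_coeff (C k)) * (\<Prod>j<m. \<Prod>i<j. x j - x i)"
    by (simp add: cofactor_def Suc)
  show ?case
  proof (cases "inj_on x {..<m}")
    case True
    have "degree Q \<le> m"
      unfolding Q_def using deg by (intro degree_sum_le) (auto intro!: order_trans[OF degree_smult_le])
    moreover have "poly Q (x i) = 0" if "i < m" for i
      unfolding det[symmetric] using that by (intro det_eq_0[of i m]) auto
    ultimately have "poly Q (x m) = coeff Q m * (\<Prod>i<m. x m - x i)"
      using True by (intro poly_eq_prod_roots)
    moreover have "coeff Q m = cofactor (?A x) m m * lead_coeff (C m)"
    proof -
      have "coeff (C j) m = 0" if "j < m" for j using that deg by (intro coeff_eq_0) simp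
      then show ?thesis by (simp add: Q_def coeff_sum deg)
    qed
    ultimately show ?thesis
      using det[of "x m"] by (simp add: cof)
  next
    case False
    then obtain i j where ij: "i < m" "j < m" "i \<noteq> j" "x i = x j" by (auto simp: inj_on_def)
    have "\<exists>j<m. \<exists>i<j. x j = x i"
      using ij by (metis linorder_neqE_nat)
    then have "(\<Prod>j<m. \<Prod>i<j. x j - x i) = 0"
      by (auto intro!: prod_zero)
    moreover have "Determinant.det (?A x) = 0"
      using ij by (intro det_eq_0[of i j]) auto
    ultimately show ?thesis by simp
  qed
qed

lemma vandermonde_1_eq_square: "vandermonde N 1 x = (\<Prod>j<N. \<Prod>i<j. x j - x i)\<^sup>2"
proof (induction N)
  case (Suc m)
  have "(\<Prod>i<m. \<bar>x m - x i\<bar> powr (2 * 1)) = (\<Prod>i<m. x m - x i)\<^sup>2"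
    unfolding prod_power_distrib by (intro prod.cong) auto
  then show ?case by (simp only: vandermonde_Suc Suc prod.lessThan_Suc power_mult_distrib)
qed simp

text \<open>The kernel matrix is the matrix of polynomial values times its transpose, so its
  determinant is a square.\<close>

lemma det_projection_kernel:
  assumes deg: "\<And>k. degree (C k) = k"
  shows "Determinant.det (Matrix.mat (Suc n) (Suc n) (\<lambda>(i, j). projection_kernel C n (x i) (x j)))
       = (\<Prod>k<Suc n. lead_coeff (C k))\<^sup>2 * vandermonde (Suc n) 1 x"
proof -
  let ?P = "Matrix.mat (Suc n) (Suc n) (\<lambda>(i, j). poly (C j) (x i))"
  have "Matrix.mat (Suc n) (Suc n) (\<lambda>(i, j). projection_kernel C n (x i) (x j)) = ?P * ?P\<^sup>T"
    by (intro eq_matI)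
      (auto simp: projection_kernel_def scalar_prod_def atLeast0LessThan lessThan_Suc_atMost intro!: sum.cong)
  then have "Determinant.det (Matrix.mat (Suc n) (Suc n) (\<lambda>(i, j). projection_kernel C n (x i) (x j)))
      = Determinant.det ?P * Determinant.det ?P\<^sup>T"
    by (simp add: det_mult[of _ "Suc n"])
  also have "\<dots> = (Determinant.det ?P)\<^sup>2"
    by (simp add: det_transpose[of _ "Suc n"] power2_eq_square)
  finally show ?thesis
    unfolding det_poly_vandermonde[OF deg] vandermonde_1_eq_square by (simp only: power_mult_distrib)
qed

section \<open>From the Gegenbauer weight to the beta weight\<close>

lemma gegenbauer_measure_eq_distr:
  assumes l: "l > -1/2"
  obtains c where "c > 0"
    "gegenbauer_measure l = density (distr (beta_measure (l + 1/2) (l + 1/2)) borel (\<lambda>u. 2 * u - 1)) (\<lambda>_. ennreal c)"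
proof
  define K where "K = Gamma (l + 1) / (sqrt pi * Gamma (l + 1/2))"
  \<comment> \<open>The 2 is the Jacobian of x = 2 u - 1, and the power of 4 comes from 1 - x^2 = 4
    u (1 - u).\<close>
  define c where "c = 2 * (K * 4 powr (l - 1/2))"
  let ?T = "\<lambda>u :: real. 2 * u - 1"
  let ?w = "\<lambda>x. ennreal (indicator {-1..1} x * gegenbauer_weight l x)"
  let ?b = "\<lambda>x. ennreal (indicator {0..1} x * (x powr (l + 1/2 - 1) * (1 - x) powr (l + 1/2 - 1)))"
  have "K > 0" unfolding K_def using l by (intro divide_pos_pos mult_pos_pos Gamma_real_pos) auto
  then show "c > 0" by (simp add: c_def)
  have w[measurable]: "?w \<in> borel_measurable borel"
    unfolding gegenbauer_weight_def by measurable
  have T[measurable]: "?T \<in> measurable borel borel" by measurable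
  have weight: "ennreal 2 * ?w (?T u) = ?b u * ennreal c" for u
  proof (cases "u \<in> {0..1}")
    case True
    have "1 - (2 * u - 1)\<^sup>2 = 4 * (u * (1 - u))" by (simp add: power2_eq_square algebra_simps)
    then have "gegenbauer_weight l (?T u) = K * 4 powr (l - 1/2) * (u powr (l - 1/2) * (1 - u) powr (l - 1/2))"
      by (simp add: gegenbauer_weight_def K_def powr_mult)
    then show ?thesis
      using True \<open>K > 0\<close>
      by (simp add: c_def ennreal_mult'[symmetric] ennreal_mult''[symmetric] mult_ac del: ennreal_numeral)
  next
    case False
    then show ?thesis by (auto simp: indicator_def)
  qed
  have "gegenbauer_measure l = density (density (distr lborel borel (\<lambda>x. -1 + 2 * x)) (\<lambda>_. ennreal 2)) ?w"
    unfolding gegenbauer_measure_def using lborel_real_affine[of 2 "-1"] by simp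
  also have "\<dots> = density (distr lborel borel ?T) (\<lambda>x. ennreal 2 * ?w x)"
    by (subst density_density_eq) (auto simp: add.commute)
  also have "\<dots> = distr (density lborel (\<lambda>u. ennreal 2 * ?w (?T u))) borel ?T"
    by (subst density_distr) auto
  also have "\<dots> = distr (density lborel (\<lambda>u. ?b u * ennreal c)) borel ?T"
    by (simp only: weight)
  also have "\<dots> = distr (density (beta_measure (l + 1/2) (l + 1/2)) (\<lambda>_. ennreal c)) borel ?T"
    unfolding beta_measure_def by (subst density_density_eq) auto
  also have "\<dots> = density (distr (beta_measure (l + 1/2) (l + 1/2)) borel ?T) (\<lambda>_. ennreal c)"
    by (subst density_distr) (auto cong: measurable_cong_sets)
  finally show "gegenbauer_measure l = \<dots>" .
qed

lemma gegenbauer_PiM: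
  assumes l: "l > -1/2"
  obtains c where "c > 0"
    "PiM {..<N} (\<lambda>_. gegenbauer_measure l) = density (distr (beta_PiM N (l + 1/2) (l + 1/2))
       (PiM {..<N} (\<lambda>_. borel)) (\<lambda>x. \<lambda>i\<in>{..<N}. 2 * x i - 1)) (\<lambda>_. ennreal c)"
proof -
  obtain c where c: "c > 0" "gegenbauer_measure l
      = density (distr (beta_measure (l + 1/2) (l + 1/2)) borel (\<lambda>u. 2 * u - 1)) (\<lambda>_. ennreal c)"
    by (rule gegenbauer_measure_eq_distr[OF l])
  let ?B = "beta_measure (l + 1/2) (l + 1/2)"
  have B: "finite_measure ?B" using l by (intro finite_measure_beta_measure) auto
  have T: "(\<lambda>u. 2 * u - 1 :: real) \<in> measurable ?B borel" by measurable
  interpret D: finite_measure "distr ?B borel (\<lambda>u. 2 * u - 1)"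
    by (rule finite_measure.finite_measure_distr[OF B T])
  interpret S: finite_measure "density (distr ?B borel (\<lambda>u. 2 * u - 1)) (\<lambda>_. ennreal c)"
    by (rule finite_measureI)
      (simp only: space_density emeasure_density_const[OF sets.top] infinity_ennreal_def ennreal_mult_eq_top_iff
        D.emeasure_finite ennreal_neq_top, simp)
  have "PiM {..<N} (\<lambda>_. gegenbauer_measure l)
      = density (PiM {..<N} (\<lambda>_. distr ?B borel (\<lambda>u. 2 * u - 1))) (\<lambda>x. \<Prod>i<N. ennreal c)"
    unfolding c(2) by (rule PiM_density_const) (auto intro: D.sigma_finite_measure_axioms S.sigma_finite_measure_axioms)
  also have "\<dots> = density (distr (beta_PiM N (l + 1/2) (l + 1/2)) (PiM {..<N} (\<lambda>_. borel)) (\<lambda>x. \<lambda>i\<in>{..<N}. 2 * x i - 1))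
      (\<lambda>_. ennreal (c ^ N))"
    unfolding PiM_distr_const[OF finite_lessThan B T] using c(1) by (simp add: ennreal_power)
  finally show thesis using c(1) by (intro that[of "c ^ N"]) auto
qed

text \<open>For k = N the correlation function sees all points at once, and for a symmetric test
  function the \<open>card S\<close> orderings contribute equally. Testing the constant 1 gives
  \<open>card S\<close> as the total mass of \<open>D\<close>; testing the positive and the negative
  part of \<open>G\<close> gives the expectation with the same factor.\<close>

lemma determinantal_points_expectation:
  fixes D G :: "(nat \<Rightarrow> real) \<Rightarrow> real"
  assumes dpp: "determinantal_points \<sigma> K N M X" and \<sigma>: "sets \<sigma> = sets borel"
    and det: "\<And>x. Determinant.det (Matrix.mat N N (\<lambda>(i, j). K (x i) (x j))) = D x"
    and D: "\<And>x. D x \<ge> 0" "D \<in> borel_measurable (PiM {..<N} (\<lambda>_. borel))"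
    and G: "G \<in> borel_measurable (PiM {..<N} (\<lambda>_. borel))"
    and sym: "\<And>s x. bij_betw s {..<N} {..<N} \<Longrightarrow> G (\<lambda>i\<in>{..<N}. x (s i)) = G x"
    and int: "integrable (PiM {..<N} (\<lambda>_. \<sigma>)) (\<lambda>x. D x * G x)"
  shows "(\<integral>\<omega>. G (\<lambda>i. X i \<omega>) \<partial>M) * (\<integral>x. D x \<partial>PiM {..<N} (\<lambda>_. \<sigma>)) = (\<integral>x. D x * G x \<partial>PiM {..<N} (\<lambda>_. \<sigma>))"
    and "(\<integral>x. D x \<partial>PiM {..<N} (\<lambda>_. \<sigma>)) > 0"
proof -
  let ?P = "PiM {..<N} (\<lambda>_. \<sigma>)"
  define S where "S = {s \<in> {..<N} \<rightarrow>\<^sub>E {..<N}. inj_on s {..<N}}"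
  interpret prob_space M using dpp by (simp add: determinantal_points_def)
  have X: "X i \<in> borel_measurable M" if "i < N" for i
    using dpp that by (simp add: determinantal_points_def)
  have cor: "(\<integral>\<^sup>+ \<omega>. (\<Sum>s\<in>S. f (\<lambda>i\<in>{..<N}. X (s i) \<omega>)) \<partial>M) = (\<integral>\<^sup>+ x. ennreal (D x) * f x \<partial>?P)"
    if "f \<in> borel_measurable (PiM {..<N} (\<lambda>_. borel))" for f :: "(nat \<Rightarrow> real) \<Rightarrow> ennreal"
    using dpp[unfolded determinantal_points_def, THEN conjunct2, THEN conjunct2, THEN conjunct2,
        rule_format, OF that]
    by (simp only: det S_def)
  have finS: "finite S" unfolding S_def by (rule finite_subset[OF _ finite_PiE[of "{..<N}" "\<lambda>_. {..<N}"]]) auto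
  have "(\<lambda>i\<in>{..<N}. i) \<in> S" by (auto simp: S_def inj_on_def)
  then have q: "card S > 0" using finS by (auto simp: card_gt_0_iff)
  have bij: "bij_betw s {..<N} {..<N}" if "s \<in> S" for s
    using that endo_inj_surj[of "{..<N}" s] by (auto simp: S_def bij_betw_def PiE_iff)
  have key: "of_nat (card S) * (\<integral>\<^sup>+ \<omega>. ennreal (H (\<lambda>i. X i \<omega>)) \<partial>M) = (\<integral>\<^sup>+ x. ennreal (D x * H x) \<partial>?P)
      \<and> (\<lambda>\<omega>. H (\<lambda>i. X i \<omega>)) \<in> borel_measurable M"
    if H: "H \<in> borel_measurable (PiM {..<N} (\<lambda>_. borel))"
      and symH: "\<And>s x. bij_betw s {..<N} {..<N} \<Longrightarrow> H (\<lambda>i\<in>{..<N}. x (s i)) = H x" for H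
  proof -
    \<comment> \<open>The family \<open>\<lambda>i. X i \<omega>\<close> is not restricted to the
      first N indices. Symmetry for the identity says that \<open>H\<close> ignores all others, so
      measurability can be taken from the product space.\<close>
    have r: "H (\<lambda>i\<in>{..<N}. x i) = H x" for x using symH[of "\<lambda>i. i"] by (simp add: bij_betw_def)
    have "(\<lambda>\<omega>. \<lambda>i\<in>{..<N}. X i \<omega>) \<in> measurable M (PiM {..<N} (\<lambda>_. borel))"
      using X by (intro measurable_restrict) auto
    from measurable_compose[OF this H] have mH: "(\<lambda>\<omega>. H (\<lambda>i. X i \<omega>)) \<in> borel_measurable M"
      unfolding r .
    have "(\<integral>\<^sup>+ \<omega>. (\<Sum>s\<in>S. ennreal (H (\<lambda>i\<in>{..<N}. X (s i) \<omega>))) \<partial>M) = (\<integral>\<^sup>+ \<omega>. of_nat (card S) * ennreal (H (\<lambda>i. X i \<omega>)) \<partial>M)"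
    proof (intro nn_integral_cong)
      fix \<omega>
      have "H (\<lambda>i\<in>{..<N}. X (s i) \<omega>) = H (\<lambda>i. X i \<omega>)" if "s \<in> S" for s
        using symH[OF bij[OF that], of "\<lambda>i. X i \<omega>"] .
      then show "(\<Sum>s\<in>S. ennreal (H (\<lambda>i\<in>{..<N}. X (s i) \<omega>))) = of_nat (card S) * ennreal (H (\<lambda>i. X i \<omega>))"
        by simp
    qed
    also have "\<dots> = of_nat (card S) * (\<integral>\<^sup>+ \<omega>. ennreal (H (\<lambda>i. X i \<omega>)) \<partial>M)"
      using mH by (intro nn_integral_cmult) auto
    finally show ?thesis
      using cor[of "\<lambda>x. ennreal (H x)"] H mH D by (simp add: ennreal_mult')
  qed
  have sets_P: "sets ?P = sets (PiM {..<N} (\<lambda>_. borel))" using \<sigma> by (intro sets_PiM_cong) auto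
  have "(\<integral>\<^sup>+ x. ennreal (D x) \<partial>?P) = ennreal (real (card S))"
    using key[of "\<lambda>_. 1"] emeasure_space_1 by (simp add: ennreal_of_nat_eq_real_of_nat)
  moreover have "D \<in> borel_measurable ?P" using D(2) by (simp cong: measurable_cong_sets add: sets_P)
  ultimately have intD: "(\<integral>x. D x \<partial>?P) = real (card S)"
    using D(1) by (subst integral_eq_nn_integral) auto
  then show "(\<integral>x. D x \<partial>?P) > 0" using q by simp
  have keyG: "of_nat (card S) * (\<integral>\<^sup>+ \<omega>. ennreal (G (\<lambda>i. X i \<omega>)) \<partial>M) = (\<integral>\<^sup>+ x. ennreal (D x * G x) \<partial>?P)
      \<and> (\<lambda>\<omega>. G (\<lambda>i. X i \<omega>)) \<in> borel_measurable M"
    by (rule key[OF G]) (rule sym)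
  define A where "A = (\<integral>\<^sup>+ \<omega>. ennreal (G (\<lambda>i. X i \<omega>)) \<partial>M)"
  define B where "B = (\<integral>\<^sup>+ \<omega>. ennreal (- G (\<lambda>i. X i \<omega>)) \<partial>M)"
  have A: "of_nat (card S) * A = (\<integral>\<^sup>+ x. ennreal (D x * G x) \<partial>?P)" and mG: "(\<lambda>\<omega>. G (\<lambda>i. X i \<omega>)) \<in> borel_measurable M"
    using keyG unfolding A_def by blast+
  have B: "of_nat (card S) * B = (\<integral>\<^sup>+ x. ennreal (- (D x * G x)) \<partial>?P)"
  proof -
    have "of_nat (card S) * (\<integral>\<^sup>+ \<omega>. ennreal (- G (\<lambda>i. X i \<omega>)) \<partial>M) = (\<integral>\<^sup>+ x. ennreal (D x * - G x) \<partial>?P)"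
      by (rule conjunct1[OF key]) (use G in simp, simp only: sym)
    then show ?thesis by (simp only: B_def mult_minus_right)
  qed
  \<comment> \<open>Integrability is known for the product measure; through \<open>A\<close> and
    \<open>B\<close> it passes to \<open>M\<close>, so that the expectation is a genuine
    integral.\<close>
  have fin: "of_nat (card S) * A \<noteq> \<infinity>" "of_nat (card S) * B \<noteq> \<infinity>"
    using int unfolding A B real_integrable_def by auto
  then have "A \<noteq> \<infinity>" "B \<noteq> \<infinity>" using q by (auto simp: ennreal_mult_eq_top_iff)
  then have "integrable M (\<lambda>\<omega>. G (\<lambda>i. X i \<omega>))"
    unfolding real_integrable_def using mG by (simp add: A_def B_def)
  then have e1: "(\<integral>\<omega>. G (\<lambda>i. X i \<omega>) \<partial>M) = enn2real A - enn2real B"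
    by (simp add: real_lebesgue_integral_def A_def B_def)
  have e2: "(\<integral>x. D x * G x \<partial>?P) = enn2real (of_nat (card S) * A) - enn2real (of_nat (card S) * B)"
    using int by (simp add: real_lebesgue_integral_def A B)
  show "(\<integral>\<omega>. G (\<lambda>i. X i \<omega>) \<partial>M) * (\<integral>x. D x \<partial>?P) = (\<integral>x. D x * G x \<partial>?P)"
    unfolding intD e1 e2 by (simp add: enn2real_mult ennreal_of_nat_eq_real_of_nat algebra_simps)
qed

section \<open>The logarithmic energy of the determinantal points\<close>

lemma log_energy_permute:
  assumes s: "bij_betw s {..<N} {..<N}"
  shows "log_energy N (\<lambda>i\<in>{..<N}. x (s i)) = log_energy N x"
proof -
  have inj: "inj_on s {..<N}" and img: "s ` {..<N} = {..<N}" using s by (auto simp: bij_betw_def)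
  have inner: "(\<Sum>j\<in>{..<N} - {i}. ln \<bar>x (s i) - x (s j)\<bar>) = (\<Sum>j\<in>{..<N} - {s i}. ln \<bar>x (s i) - x j\<bar>)" if i: "i < N" for i
  proof (rule sum.reindex_bij_betw)
    have "s ` ({..<N} - {i}) = {..<N} - {s i}"
      using inj_on_image_set_diff[OF inj, of "{..<N}" "{i}"] i img by auto
    then show "bij_betw s ({..<N} - {i}) ({..<N} - {s i})"
      using inj by (auto simp: bij_betw_def inj_on_diff)
  qed
  have "(\<Sum>i<N. \<Sum>j\<in>{..<N} - {i}. ln \<bar>x (s i) - x (s j)\<bar>) = (\<Sum>i<N. \<Sum>j\<in>{..<N} - {s i}. ln \<bar>x (s i) - x j\<bar>)"
    by (intro sum.cong inner) auto
  also have "\<dots> = (\<Sum>i<N. \<Sum>j\<in>{..<N} - {i}. ln \<bar>x i - x j\<bar>)"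
    by (rule sum.reindex_bij_betw[OF s])
  finally show ?thesis by (simp add: log_energy_def)
qed

lemma measurable_log_energy: "log_energy N \<in> borel_measurable (PiM {..<N} (\<lambda>_. borel))"
  unfolding log_energy_def by measurable

text \<open>For distinct points the energy is - ln V. If two points coincide the factor V is 0,
  whatever the default value of \<open>ln\<close> at 0 makes of the energy.\<close>

lemma vandermonde_mult_log_energy: "vandermonde N 1 x * log_energy N x = - (vandermonde N 1 x * ln (vandermonde N 1 x))"
proof (cases "\<exists>i<N. \<exists>j<N. i \<noteq> j \<and> x i = x j")
  case True
  then show ?thesis using vandermonde_eq_0 by fastforce
next
  case False
  then have *: "\<bar>x i - x j\<bar> > 0" if "i < N" "j \<in> {..<N} - {i}" for i j using that by auto
  have "ln (vandermonde N 1 x) = (\<Sum>i<N. ln (\<Prod>j\<in>{..<N} - {i}. \<bar>x i - x j\<bar>))"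
    unfolding vandermonde_def using * by (subst ln_prod) (auto intro!: prod_pos)
  also have "\<dots> = (\<Sum>i<N. \<Sum>j\<in>{..<N} - {i}. ln \<bar>x i - x j\<bar>)"
    using * by (intro sum.cong refl ln_prod) auto
  finally show ?thesis by (simp add: log_energy_def)
qed

lemma vandermonde_affine:
  "vandermonde N 1 (\<lambda>i\<in>{..<N}. 2 * x i - 1) = 2 ^ (N * (N - 1)) * vandermonde N 1 x"
proof -
  have dist: "\<bar>2 * u - 2 * v\<bar> = 2 * \<bar>u - v\<bar>" for u v :: real
    by (simp add: abs_if)
  have "vandermonde N 1 (\<lambda>i\<in>{..<N}. 2 * x i - 1) = (\<Prod>i<N. \<Prod>j\<in>{..<N} - {i}. 2 * \<bar>x i - x j\<bar>)"
    unfolding vandermonde_def by (intro prod.cong) (auto simp: dist)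
  also have "\<dots> = (\<Prod>i<N. 2 ^ (N - 1)) * vandermonde N 1 x"
    unfolding vandermonde_def prod.distrib[symmetric] by (intro prod.cong) (auto simp: prod.distrib)
  finally show ?thesis by (simp add: power_mult[symmetric] mult.commute)
qed

text \<open>The total mass of the density and the integral of density times energy share the factor
  \<open>c * \<kappa> * t * s\<close>. Their quotient is - (ln t + L), where \<open>L\<close> is the
  logarithmic derivative of the Selberg integral and \<open>t\<close> collects the doubling of all
  ordered distances.\<close>

lemma expected_log_energy_eq_jacobi_energy:
  assumes l: "l > -1/2" and deg: "\<And>k. degree (C k) = k"
    and dpp: "determinantal_points (gegenbauer_measure l) (projection_kernel C n) (n + 1) M X"
  shows "expected_log_energy M (n + 1) X = jacobi_energy (l + 1/2) n"
proof -
  define N where "N = Suc n"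
  define a where "a = l + 1/2"
  define t where "t = (2 :: real) ^ (N * (N - 1))"
  define \<kappa> where "\<kappa> = (\<Prod>k<N. lead_coeff (C k))\<^sup>2"
  let ?B = "beta_PiM N a a" and ?P = "PiM {..<N} (\<lambda>_. gegenbauer_measure l)"
  let ?T = "\<lambda>x. \<lambda>i\<in>{..<N}. 2 * x i - 1 :: real"
  let ?D = "\<lambda>x. \<kappa> * vandermonde N 1 x"
  have a: "a > 0" using l by (simp add: a_def)
  have t: "t > 0" by (simp add: t_def)
  have \<kappa>: "\<kappa> \<ge> 0" by (simp add: \<kappa>_def)
  obtain c where c: "c > 0" "?P = density (distr ?B (PiM {..<N} (\<lambda>_. borel)) ?T) (\<lambda>_. ennreal c)"
    using gegenbauer_PiM[OF l] unfolding a_def by blast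
  have T: "?T \<in> measurable ?B (PiM {..<N} (\<lambda>_. borel))"
    by (intro measurable_restrict) measurable
  have int_P: "(\<integral>x. f x \<partial>?P) = c * (\<integral>x. f (?T x) \<partial>?B)"
    and integrable_P: "integrable ?P f \<longleftrightarrow> integrable ?B (\<lambda>x. f (?T x))"
    if f: "f \<in> borel_measurable (PiM {..<N} (\<lambda>_. borel))" for f :: "(nat \<Rightarrow> real) \<Rightarrow> real"
  proof -
    show "(\<integral>x. f x \<partial>?P) = c * (\<integral>x. f (?T x) \<partial>?B)"
      unfolding c(2) using f c(1) integral_distr[OF T f] by (subst integral_real_density) auto
    show "integrable ?P f \<longleftrightarrow> integrable ?B (\<lambda>x. f (?T x))"
      unfolding c(2) using f c(1) integrable_distr_eq[OF T f] by (subst integrable_real_density) auto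
  qed
  have VL: "vandermonde N 1 (?T x) * log_energy N (?T x) = - t * (ln t * vandermonde N 1 x + vandermonde N 1 x * ln (vandermonde N 1 x))" for x
  proof -
    have "vandermonde N 1 (?T x) * log_energy N (?T x) = - (t * vandermonde N 1 x * ln (t * vandermonde N 1 x))"
      unfolding vandermonde_mult_log_energy unfolding vandermonde_affine t_def ..
    moreover have "vandermonde N 1 x * ln (t * vandermonde N 1 x) = vandermonde N 1 x * (ln t + ln (vandermonde N 1 x))"
      using t vandermonde_nonneg[of N 1 x] by (cases "vandermonde N 1 x = 0") (auto simp: ln_mult)
    ultimately show ?thesis by (simp add: algebra_simps)
  qed
  have mD: "?D \<in> borel_measurable (PiM {..<N} (\<lambda>_. borel))"
    by (intro borel_measurable_times borel_measurable_const measurable_vandermonde)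
  have mDL: "(\<lambda>x. ?D x * log_energy N x) \<in> borel_measurable (PiM {..<N} (\<lambda>_. borel))"
    by (intro borel_measurable_times mD measurable_log_energy)
  have intV: "integrable ?B (vandermonde N 1)" using a by (intro integrable_vandermonde) auto
  have intVL: "integrable ?B (\<lambda>x. vandermonde N 1 x * ln (vandermonde N 1 x))" by (rule integrable_vandermonde_ln_vandermonde[OF a a])
  have DL: "?D (?T x) * log_energy N (?T x) = - \<kappa> * t * (ln t * vandermonde N 1 x + vandermonde N 1 x * ln (vandermonde N 1 x))" for x
    using VL[of x] by (simp add: mult.assoc)
  have int_DL: "integrable ?P (\<lambda>x. ?D x * log_energy N x)"
    unfolding integrable_P[OF mDL] DL
    by (intro integrable_mult_right Bochner_Integration.integrable_add intV intVL)
  have setsG: "sets (gegenbauer_measure l) = sets borel" by (simp add: gegenbauer_measure_def)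
  have dppN: "determinantal_points (gegenbauer_measure l) (projection_kernel C n) N M X"
    using dpp by (simp add: N_def)
  have detN: "Determinant.det (Matrix.mat N N (\<lambda>(i, j). projection_kernel C n (x i) (x j))) = ?D x" for x
    unfolding N_def \<kappa>_def by (rule det_projection_kernel[OF deg])
  have Dpos: "?D x \<ge> 0" for x using \<kappa> by simp
  note E = determinantal_points_expectation[OF dppN setsG detN Dpos mD measurable_log_energy log_energy_permute int_DL]
  define L where "L = (\<Sum>j<N. 2 * real j * Digamma (a + real j) + real (j + 1) * Digamma (real j + 2)
      - real (N - 1 + j) * Digamma (2 * a + real (N - 1 + j)) - Digamma 2)"
  define s where "s = selberg N a a 1"
  have I1: "(\<integral>x. ?D x \<partial>?P) = c * \<kappa> * t * s"
    unfolding int_P[OF mD] vandermonde_affine t_def[symmetric] s_def selberg_def by simp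
  have I2: "(\<integral>x. ?D x * log_energy N x \<partial>?P) = - (c * \<kappa> * t * s) * (ln t + L)"
  proof -
    have "(\<integral>x. ?D x * log_energy N x \<partial>?P) = c * (- \<kappa> * t * (ln t * s + s * L))"
      unfolding int_P[OF mDL] DL integral_mult_right_zero
        Bochner_Integration.integral_add[OF integrable_mult_right[OF intV] intVL]
        integral_vandermonde_ln_vandermonde[OF a] s_def selberg_def L_def ..
    then show ?thesis by (simp add: algebra_simps)
  qed
  have "expected_log_energy M N X * (c * \<kappa> * t * s) = - (ln t + L) * (c * \<kappa> * t * s)"
    using E(1) unfolding I1 I2 expected_log_energy_def by (simp only: mult_minus_left mult.commute)
  \<comment> \<open>This product is the total mass of the density, which is positive because it
    counts the orderings of the points.\<close>
  moreover have "c * \<kappa> * t * s \<noteq> 0" using E(2) unfolding I1 by (rule less_imp_neq[symmetric])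
  ultimately have "expected_log_energy M N X = - (ln t + L)"
    by (metis mult_right_cancel)
  moreover have "ln t = real n * real (n + 1) * ln 2"
    by (simp add: t_def N_def ln_realpow algebra_simps)
  moreover have "L = (\<Sum>j\<le>n. 2 * real j * Digamma (a + real j) + real (j + 1) * Digamma (real j + 2)
          - real (n + j) * Digamma (2 * a + real (n + j)) - Digamma 2)"
    by (simp only: L_def N_def diff_Suc_1 lessThan_Suc_atMost)
  ultimately show ?thesis
    by (simp add: jacobi_energy_def N_def a_def)
qed

theorem theorem2:
  fixes l :: real
    and C :: "nat \<Rightarrow> real poly"
    and M :: "nat \<Rightarrow> 'a measure"
    and X :: "nat \<Rightarrow> nat \<Rightarrow> 'a \<Rightarrow> real"
    and E :: "nat \<Rightarrow> real"
  assumes "l > -1/2"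
    and "orthonormal_polynomials (gegenbauer_measure l) C"
    and "\<And>n. determinantal_points (gegenbauer_measure l) (projection_kernel C n) (n + 1) (M n) (X n)"
  defines "E \<equiv> \<lambda>n. expected_log_energy (M n) (n + 1) (X n)"
  shows
    "(\<lambda>n. E n - ((real n + 1)^2 * ln 2 - (real n + 1) * ln (real n + 1)
                 + (1 - euler_mascheroni - 2 * ln 2) * real n)) \<in> o(\<lambda>n. real n)
     \<and> (l = 0 \<longrightarrow>
         (\<forall>n\<ge>1. E n = (real n + 1)^2 * ln 2
             - ((real n + 1) * ln 2 + 3/4 * harm n + real n * harm (2 * n - 1)
                + harm (2 * n) / 2 - real n + 1/2))
         \<and> (\<lambda>n. E n - ((real n + 1)^2 * ln 2 - (real n + 1) * ln (real n + 1)
                 + (1 - euler_mascheroni - 2 * ln 2) * real n - 1/4 * ln (real n)))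
             \<in> O(\<lambda>_. 1))"
proof -
  define a where "a = l + 1/2"
  let ?m = "\<lambda>n. (real n + 1)\<^sup>2 * ln 2 - (real n + 1) * ln (real n + 1) + (1 - euler_mascheroni - 2 * ln 2) * real n"
  have E: "E n = jacobi_energy a n" for n
    unfolding E_def a_def using assms(1-3)
    by (intro expected_log_energy_eq_jacobi_energy) (auto simp: orthonormal_polynomials_def)
  have O1: "(\<lambda>n. E n - (?m n + (a\<^sup>2 - a) * ln (real n + 1))) \<in> O(\<lambda>_. 1)"
    unfolding E using assms(1) by (intro jacobi_energy_asymp) (simp add: a_def)
  have "(\<lambda>n. E n - ?m n) \<in> o(\<lambda>n. real n)"
  proof -
    have "(\<lambda>_::nat. 1 :: real) \<in> o(\<lambda>n. real n)" by real_asymp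
    with O1 have 1: "(\<lambda>n. E n - (?m n + (a\<^sup>2 - a) * ln (real n + 1))) \<in> o(\<lambda>n. real n)"
      by (rule landau_o.big_small_trans)
    have "(\<lambda>n. ln (real n + 1)) \<in> o(\<lambda>n. real n)" by real_asymp
    then have 2: "(\<lambda>n. (a\<^sup>2 - a) * ln (real n + 1)) \<in> o(\<lambda>n. real n)" by simp
    show ?thesis using sum_in_smallo(1)[OF 1 2] by (simp add: algebra_simps)
  qed
  moreover have "(\<lambda>n. E n - (?m n - 1/4 * ln (real n))) \<in> O(\<lambda>_. 1)" if "l = 0"
  proof -
    \<comment> \<open>Here a = 1/2, so the general coefficient a^2 - a = l^2 - 1/4 of the logarithm
      becomes - 1/4; replacing ln (n + 1) by ln n then costs a bounded amount.\<close>
    have a: "a\<^sup>2 - a = - (1/4)" using that by (simp add: a_def power2_eq_square)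
    have "(\<lambda>n. - (1/4) * (ln (real n + 1) - ln (real n))) \<in> O(\<lambda>_. 1)" by real_asymp
    from sum_in_bigo(1)[OF O1[unfolded a] this] show ?thesis by (simp add: algebra_simps)
  qed
  moreover have "E n = (real n + 1)^2 * ln 2 - ((real n + 1) * ln 2 + 3/4 * harm n + real n * harm (2 * n - 1)
                + harm (2 * n) / 2 - real n + 1/2)" if "l = 0" "n \<ge> 1" for n
    using jacobi_energy_half[OF that(2)] E[of n] that(1) by (simp add: a_def)
  ultimately show ?thesis by blast
qed

end
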